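(* Let $A\subset\mathbb{R}^2$ be the Sierpiński carpet, constructed in the usual way inside the unit square $[0,1]^2$, and let $\delta>1/6$ be a fixed real number. Let $\zeta_A(s)=\int_{A_\delta}d(x,A)^{s-2}\,\mathrm{d}x$ (initially defined for $s\in\mathbb{C}$ with $\operatorname{Re}s$ sufficiently large) be the distance zeta function of $A$, and write $\mathbf{i}=\sqrt{-1}$. Then $\zeta_A$ has a (necessarily unique) meromorphic extension to the whole complex plane, still denoted by $\zeta_A$, which for all $s\in\mathbb{C}$ is given by $$\zeta_A(s)=\frac{8}{2^s s(s-1)(3^s-8)}+2\pi\frac{\delta^s}{s}+4\frac{\delta^{s-1}}{s-1}.$$ In particular, the set $\mathcal{P}(\zeta_A)$ of complex dimensions of $A$ and the set $\dim_{PC}A$ of principal complex dimensions of $A$ are given by $$\mathcal{P}(\zeta_A)=\{0,1\}\cup\dim_{PC}A,\qquad \dim_{PC}A=\log_3 8+\frac{2\pi}{\log 3}\,\mathbf{i}\,\mathbb{Z}.$$ Furthermore, each of the complex dimensions (i.e., each pole of $\zeta_A$) is simple. Moreover, for every $k\in\mathbb{Z}$, the residue of $\zeta_A$ at the principal pole $s_k:=\log_3 8+\frac{2\pi}{\log 3}k\,\mathbf{i}$ is $$\operatorname{res}(\zeta_A,s_k)=\frac{2^{-s_k}}{(\log 3)\,s_k(s_k-1)}.$$ Finally, with $D:=\log_3 8$, the approximate values (to the six decimal places displayed) of the lower and upper $D$-dimensional Minkowski contents of $A$ are $\mathcal{M}_*^D(A)\approx 1.350670$ and $\mathcal{M}^{*D}(A)\approx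 1.355617$.
   Context: The Sierpiński carpet $A$ is the compact set obtained from $[0,1]^2$ by dividing it into $9$ congruent closed squares of side $1/3$, removing the open middle square, and repeating this step ad infinitum on each of the remaining $8$ closed squares; $A$ is the intersection of the resulting decreasing sequence of compact sets. For a bounded set $A\subset\mathbb{R}^N$ (here $N=2$): $d(x,A)=\inf\{|x-y|:y\in A\}$ is the Euclidean distance, $A_t=\{x\in\mathbb{R}^N: d(x,A)<t\}$ is the open Euclidean $t$-neighborhood, and $|A_t|$ is its $N$-dimensional Lebesgue measure. For fixed $\delta>0$, the distance zeta function of $A$ is $\zeta_A(s)=\int_{A_\delta}d(x,A)^{s-N}\,\mathrm{d}x$ for $s\in\mathbb{C}$ with $\operatorname{Re}s$ sufficiently large, the integral being an (absolutely convergent) Lebesgue integral. The abscissa of (absolute) convergence $D(\zeta_A)$ is the extended real number such that $\{\operatorname{Re}s>D(\zeta_A)\}$ is the maximal open right half-plane on which this Lebesgue integral converges. When $\zeta_A$ has a meromorphic extension to $\mathbb{C}$, the set of complex dimensions $\mathcal{P}(\zeta_A)$ of $A$ is the set of poles of this extension, and the set of principal complex dimensions $\dim_{PC}A$ is the set of those poles lying on the critical line $\{\operatorname{Re}s=D(\zeta_A)\}$. For $r\in\mathbb{R}$, the lower and upper $r$-dimensional Minkowski contents of $A$ are $$\mathcal{M}_*^r(A)=\liminf_{t\to0^+}\frac{|A_t|}{t^{N-r}},\qquad \mathcal{M}^{*r}(A)=\limsup_{t\to0^+}\frac{|A_t|}{t^{N-r}}.$$ The notation $c+\frac{2\pi}{\log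 3}\mathbf{i}\mathbb{Z}$ means $\{c+\frac{2\pi}{\log 3}\mathbf{i}k: k\in\mathbb{Z}\}$; $\log$ is the natural logarithm and $\log_3$ the logarithm to base $3$. *)

theory Defs
  imports "HOL-Complex_Analysis.Complex_Analysis"
begin

(* Lower left corners of the 8^n closed squares of side 1/3^n that make up stage n:
   each square is cut into a 3 x 3 grid, of which the cell (1,1) is dropped. *)
primrec carpet_corners :: "nat \<Rightarrow> (real^2) set" where
  "carpet_corners 0 = {0}"
| "carpet_corners (Suc n) =
     {p + (1 / 3 ^ Suc n) *\<^sub>R vector [real i, real j] | p i j.
        p \<in> carpet_corners n \<and> i \<in> {0,1,2} \<and> j \<in> {0,1,2} \<and> (i, j) \<noteq> (1::nat, 1::nat)}"

definition carpet_stage :: "nat \<Rightarrow> (real^2) set" where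
  "carpet_stage n = (\<Union>p\<in>carpet_corners n. cbox p (p + (1 / 3 ^ n) *\<^sub>R vector [1, 1]))"

definition sierpinski_carpet :: "(real^2) set" where
  "sierpinski_carpet = (\<Inter>n. carpet_stage n)"

definition nbhd :: "'a::euclidean_space set \<Rightarrow> real \<Rightarrow> 'a set" where
  "nbhd A t = {x. infdist x A < t}"

(* On A itself the integrand is 0 powr (s - N), which is 0 by convention in HOL
   even if Re s \<le> N.  This is harmless only for sets A of measure zero, such as the carpet. *)
definition dist_power :: "'a::euclidean_space set \<Rightarrow> complex \<Rightarrow> 'a \<Rightarrow> complex" where
  "dist_power A s x = complex_of_real (infdist x A) powr (s - of_nat DIM('a))"

definition distance_zeta :: "'a::euclidean_space set \<Rightarrow> real \<Rightarrow> complex \<Rightarrow> complex" where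
  "distance_zeta A \<delta> s = set_lebesgue_integral lebesgue (nbhd A \<delta>) (dist_power A s)"

definition abscissa :: "'a::euclidean_space set \<Rightarrow> real \<Rightarrow> ereal" where
  "abscissa A \<delta> =
     Inf {ereal \<sigma> | \<sigma>. \<forall>s. Re s > \<sigma> \<longrightarrow> set_integrable lebesgue (nbhd A \<delta>) (dist_power A s)}"

(* Meromorphic functions are total functions here; being nicely meromorphic normalizes their
   values (continuity at non-poles, value 0 at poles), so that the extension is unique as a function. *)
definition zeta_extension :: "'a::euclidean_space set \<Rightarrow> real \<Rightarrow> (complex \<Rightarrow> complex) \<Rightarrow> bool" where
  "zeta_extension A \<delta> Z \<longleftrightarrow>
     Z nicely_meromorphic_on UNIV \<and>
     (\<forall>s. ereal (Re s) > abscissa A \<delta> \<longrightarrow> Z s = distance_zeta A \<delta> s)"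

definition zeta_mero :: "'a::euclidean_space set \<Rightarrow> real \<Rightarrow> complex \<Rightarrow> complex" where
  "zeta_mero A \<delta> = (THE Z. zeta_extension A \<delta> Z)"

definition complex_dims :: "'a::euclidean_space set \<Rightarrow> real \<Rightarrow> complex set" where
  "complex_dims A \<delta> = {s. is_pole (zeta_mero A \<delta>) s}"

definition principal_complex_dims :: "'a::euclidean_space set \<Rightarrow> real \<Rightarrow> complex set" where
  "principal_complex_dims A \<delta> = {s \<in> complex_dims A \<delta>. ereal (Re s) = abscissa A \<delta>}"

definition lower_minkowski_content :: "real \<Rightarrow> 'a::euclidean_space set \<Rightarrow> ereal" where
  "lower_minkowski_content r A =
     Liminf (at_right 0) (\<lambda>t. ereal (measure lebesgue (nbhd A t) / t powr (real DIM('a) - r)))"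

definition upper_minkowski_content :: "real \<Rightarrow> 'a::euclidean_space set \<Rightarrow> ereal" where
  "upper_minkowski_content r A =
     Limsup (at_right 0) (\<lambda>t. ereal (measure lebesgue (nbhd A t) / t powr (real DIM('a) - r)))"

definition carpet_pole :: "int \<Rightarrow> complex" where
  "carpet_pole k = of_real (log 3 8) + of_real (2 * pi / ln 3) * of_int k * \<i>"

end

theory Submission
  imports Defs
begin

text \<open>The carpet is made of the sides of the unit square and of the sides of all the holes, up to
closure: every hole of side \<open>a\<close> has its boundary in the carpet, and so has the unit
square. The distance to the carpet is therefore the distance to the sides of the surrounding hole
for a point of a hole, and the distance to the square for a point outside the square.

The first consequence is a formula for the area of the neighbourhoods of the carpet. Zooming by
the factor 3 shows that the area \<open>F(t)\<close> of the points of the unit square at distance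
at least \<open>t\<close> from the carpet satisfies \<open>F(t) = 8/9 F(3t) + (max 0 (1/3 -
2t))^2\<close> (\<open>far_measure_self_similar\<close>), because 8 of the 9 cells are copies of
the whole picture and a square of side \<open>1/3 - 2t\<close> survives in the ninth. Iterating
gives the sum over the holes, and Steiner's formula \<open>1 + 4t + pi t^2\<close> for the
neighbourhood of the square accounts for the outside; together they give
\<open>carpet_nbhd_measure\<close>.

The second step reads this area as the distribution function of the distance
(\<open>carpet_dist_distribution\<close>): the zeta function becomes the integral over \<open>0 <
t < \<delta>\<close> of \<open>t^(s-2)\<close> times the density \<open>4 + 2 pi t + (\<Sum>k. 4
8^k max 0 (a - 2t))\<close>, where \<open>a = 3^(-k-1)\<close>. Since \<open>\<delta> >
1/6\<close>, no hole is cut off, and one hole of side \<open>a\<close> contributes \<open>8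
(a/2)^s / (s (s-1))\<close>. The sum over the holes is a geometric series of ratio \<open>8 /
3^s\<close>. It converges for \<open>Re s > log 3 8\<close>, and for \<open>s = log 3 8\<close>
all its terms are equal and positive, so this is the abscissa. The closed formula is meromorphic,
hence it is the extension, unique by the identity theorem. Near each of \<open>0\<close>,
\<open>1\<close> and the zeros of \<open>3^s - 8\<close> it is a quotient of an analytic function
that does not vanish and one with a simple zero; this gives the poles, their order and the
residues.

For the Minkowski contents write \<open>t = u / 3^m\<close> with \<open>1/6 <= u <= 1/2\<close>.
Then the quotient whose lower and upper limits are sought is \<open>g(u)\<close>, where
\<open>g(u) = u^(D-2) (1 + 4u/5 - 4u^2/7)\<close> and \<open>D = log 3 8\<close>, plus a
nonnegative term that tends to 0 (\<open>minkowski_ratio\<close>), and the two contents are the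
minimum and the maximum of \<open>g\<close> on this interval. The sign of \<open>g'\<close> is
that of a concave quadratic polynomial with two roots in the interval, so \<open>g\<close>
decreases, increases and decreases again, with \<open>g(1/6) = g(1/2)\<close>. Replacing the roots
by nearby rational numbers costs an error of order \<open>10^-8\<close>
(\<open>carpet_log_profile_between\<close>), and the values there follow from rational estimates
of logarithms.\<close>

(* Keeps $ for vector components only. *)
no_notation fps_nth (infixl "$" 75)

section \<open>Self-similarity of the carpet and the distance to it\<close>

definition unit_square :: "(real^2) set" where
  "unit_square = cbox 0 (vector [1, 1])"

definition square_boundary :: "(real^2) set" where
  "square_boundary = {x \<in> unit_square. x$1 = 0 \<or> x$1 = 1 \<or> x$2 = 0 \<or> x$2 = 1}"

text \<open>The positions of the cells that a subdivision keeps; \<open>(1, 1)\<close> is the hole.\<close>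

definition digits :: "(nat \<times> nat) set" where
  "digits = {0,1,2} \<times> {0,1,2} - {(1,1)}"

definition cell_map :: "nat \<times> nat \<Rightarrow> real^2 \<Rightarrow> real^2" where
  "cell_map d x = (1/3) *\<^sub>R x + (1/3) *\<^sub>R vector [real (fst d), real (snd d)]"

lemma mem_unit_square: "x \<in> unit_square \<longleftrightarrow> 0 \<le> x$1 \<and> x$1 \<le> 1 \<and> 0 \<le> x$2 \<and> x$2 \<le> 1"
  by (auto simp: unit_square_def mem_box_cart forall_2)

lemma cell_map_nth [simp]:
  "cell_map d x $ 1 = x$1 / 3 + real (fst d) / 3" "cell_map d x $ 2 = x$2 / 3 + real (snd d) / 3"
  by (auto simp: cell_map_def)

lemma real2_eq_iff: "(x :: real^2) = y \<longleftrightarrow> x$1 = y$1 \<and> x$2 = y$2"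
  by (simp add: vec_eq_iff forall_2)

lemma finite_digits [simp]: "finite digits" and card_digits: "card digits = 8"
proof -
  have eq: "digits = {(0,0),(0,1),(0,2),(1,0),(1,2),(2,0),(2,1),(2,2)}"
    by (auto simp: digits_def)
  show "finite digits" "card digits = 8" unfolding eq by simp_all
qed

lemma corners_Suc_fine:
  "carpet_corners (Suc n) =
    (\<Union>d\<in>digits. (\<lambda>p. p + (1 / 3 ^ Suc n) *\<^sub>R vector [real (fst d), real (snd d)]) ` carpet_corners n)"
proof -
  have "{f p i j |p i j. p \<in> C \<and> i \<in> I \<and> j \<in> I \<and> (i, j) \<noteq> e}
      = (\<Union>d\<in>I \<times> I - {e}. (\<lambda>p. f p (fst d) (snd d)) ` C)"
    for f :: "real^2 \<Rightarrow> nat \<Rightarrow> nat \<Rightarrow> real^2" and C I e by force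
  then show ?thesis unfolding digits_def carpet_corners.simps .
qed

text \<open>The corners of the next stage are defined by subdividing the smallest squares. Self-similarity
needs the opposite order, eight shrunken copies of a whole stage; the two descriptions agree
because the maps \<open>cell_map d\<close> scale the finest subdivision into the next one.\<close>

lemma corners_Suc_coarse:
  "carpet_corners (Suc n) = (\<Union>d\<in>digits. cell_map d ` carpet_corners n)"
proof (induction n)
  case 0
  show ?case
    unfolding corners_Suc_fine by (simp add: cell_map_def)
next
  case (Suc n)
  let ?v = "\<lambda>d::nat\<times>nat. vector [real (fst d), real (snd d)] :: real^2"
  have comm: "cell_map e p + (1 / 3 ^ Suc (Suc n)) *\<^sub>R ?v d
      = cell_map e (p + (1 / 3 ^ Suc n) *\<^sub>R ?v d)" for e d p
    by (simp add: cell_map_def algebra_simps)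
  have "carpet_corners (Suc (Suc n)) =
      (\<Union>d\<in>digits. (\<lambda>p. p + (1 / 3 ^ Suc (Suc n)) *\<^sub>R ?v d) ` (\<Union>e\<in>digits. cell_map e ` carpet_corners n))"
    by (subst corners_Suc_fine, subst Suc.IH) simp
  also have "\<dots> = (\<Union>e\<in>digits. cell_map e ` (\<Union>d\<in>digits. (\<lambda>p. p + (1 / 3 ^ Suc n) *\<^sub>R ?v d) ` carpet_corners n))"
    by (simp only: image_UN image_image comm) blast
  also have "\<dots> = (\<Union>e\<in>digits. cell_map e ` carpet_corners (Suc n))"
    by (subst corners_Suc_fine) simp
  finally show ?case .
qed

lemma cell_map_image_cbox:
  "cell_map d ` cbox p (p + c *\<^sub>R vector [1,1]) = cbox (cell_map d p) (cell_map d p + (c/3) *\<^sub>R vector [1,1])"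
proof (intro set_eqI iffI)
  fix x assume "x \<in> cbox (cell_map d p) (cell_map d p + (c/3) *\<^sub>R vector [1,1])"
  then have "x = cell_map d (vector [3 * x$1 - fst d, 3 * x$2 - snd d])"
      "(vector [3 * x$1 - fst d, 3 * x$2 - snd d] :: real^2) \<in> cbox p (p + c *\<^sub>R vector [1,1])"
    by (auto simp: real2_eq_iff mem_box_cart forall_2 diff_divide_distrib)
  then show "x \<in> cell_map d ` cbox p (p + c *\<^sub>R vector [1,1])"
    by blast
qed (auto simp: mem_box_cart forall_2 divide_right_mono)

lemma stage_0: "carpet_stage 0 = unit_square"
  by (simp add: carpet_stage_def unit_square_def)

lemma stage_Suc: "carpet_stage (Suc n) = (\<Union>d\<in>digits. cell_map d ` carpet_stage n)"
proof -
  have eq: "1 / 3 ^ Suc n = (1 / 3 ^ n) / (3::real)" by simp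
  have "carpet_stage (Suc n) = (\<Union>d\<in>digits. \<Union>p\<in>carpet_corners n.
      cbox (cell_map d p) (cell_map d p + (1 / 3 ^ n / 3) *\<^sub>R vector [1, 1]))"
    unfolding carpet_stage_def corners_Suc_coarse eq UN_UN_flatten UN_simps ..
  then show ?thesis
    by (simp only: carpet_stage_def image_UN cell_map_image_cbox)
qed

lemma cell_map_unit_square: "d \<in> digits \<Longrightarrow> x \<in> unit_square \<Longrightarrow> cell_map d x \<in> unit_square"
  by (auto simp: mem_unit_square digits_def)

lemma stage_subset: "carpet_stage n \<subseteq> unit_square"
  by (induction n) (auto simp: stage_0 stage_Suc cell_map_unit_square)

lemma carpet_subset: "sierpinski_carpet \<subseteq> unit_square"
  using stage_subset by (auto simp: sierpinski_carpet_def)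

lemma cell_map_carpet: "d \<in> digits \<Longrightarrow> x \<in> sierpinski_carpet \<Longrightarrow> cell_map d x \<in> sierpinski_carpet"
proof -
  assume d: "d \<in> digits" and x: "x \<in> sierpinski_carpet"
  have "cell_map d x \<in> carpet_stage n" for n
  proof (cases n)
    case 0
    then show ?thesis using d x carpet_subset by (auto simp: stage_0 cell_map_unit_square)
  next
    case (Suc m)
    then show ?thesis using d x by (auto simp: stage_Suc sierpinski_carpet_def)
  qed
  then show ?thesis by (simp add: sierpinski_carpet_def)
qed

lemma third_digit:
  assumes "0 \<le> y" "y \<le> (1::real)"
  obtains j :: nat where "j \<in> {0,1,2}" "0 \<le> 3 * y - j" "3 * y - j \<le> 1"
proof -
  consider "y \<le> 1/3" | "1/3 \<le> y" "y \<le> 2/3" | "2/3 \<le> y" by linarith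
  then show ?thesis
  proof cases
    case 1 then show ?thesis using assms that[of 0] by auto
  next
    case 2 then show ?thesis using assms that[of 1] by auto
  next
    case 3 then show ?thesis using assms that[of 2] by auto
  qed
qed

text \<open>Coordinates in which the cell \<open>d\<close> becomes the unit square: the inverse of
\<open>cell_map d\<close>.\<close>

definition cell_coord :: "nat \<times> nat \<Rightarrow> real^2 \<Rightarrow> real^2" where
  "cell_coord d x = vector [3 * x$1 - fst d, 3 * x$2 - snd d]"

lemma cell_coord_nth [simp]:
  "cell_coord d x $ 1 = 3 * x$1 - fst d" "cell_coord d x $ 2 = 3 * x$2 - snd d"
  by (auto simp: cell_coord_def)

lemma cell_map_coord [simp]: "cell_map d (cell_coord d x) = x" "cell_coord d (cell_map d x) = x"
  by (auto simp: real2_eq_iff diff_divide_distrib add_divide_distrib)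

text \<open>A boundary point of the unit square lies in one of the eight outer cells, on the boundary of that
cell; so the boundary survives every stage.\<close>

lemma boundary_subset_stage: "x \<in> square_boundary \<Longrightarrow> x \<in> carpet_stage n"
proof (induction n arbitrary: x)
  case 0
  then show ?case by (simp add: stage_0 square_boundary_def)
next
  case (Suc n)
  then have x: "0 \<le> x$1" "x$1 \<le> 1" "0 \<le> x$2" "x$2 \<le> 1"
    by (auto simp: square_boundary_def mem_unit_square)
  obtain i :: nat where i: "i \<in> {0,1,2}" "0 \<le> 3 * x$1 - i" "3 * x$1 - i \<le> 1"
    using third_digit x by metis
  obtain j :: nat where j: "j \<in> {0,1,2}" "0 \<le> 3 * x$2 - j" "3 * x$2 - j \<le> 1"
    using third_digit x by metis
  have "(i, j) \<in> digits" "cell_coord (i, j) x \<in> square_boundary"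
    using i j Suc.prems by (auto simp: digits_def square_boundary_def mem_unit_square)
  then show ?case
    unfolding stage_Suc using Suc.IH cell_map_coord(1) by (metis UN_I image_eqI)
qed

lemma boundary_subset_carpet: "square_boundary \<subseteq> sierpinski_carpet"
  using boundary_subset_stage by (auto simp: sierpinski_carpet_def)

text \<open>Each side of the hole is also a side of one of the four cells adjacent to it.\<close>

lemma hole_boundary_carpet:
  assumes "c \<in> square_boundary"
  shows "cell_map (1,1) c \<in> sierpinski_carpet"
proof -
  have c: "c \<in> unit_square" "c$1 = 0 \<or> c$1 = 1 \<or> c$2 = 0 \<or> c$2 = 1"
    using assms by (auto simp: square_boundary_def)
  \<comment> \<open>The neighbouring cell that shares the side containing the point.\<close>
  define d :: "nat \<times> nat" where
    "d = (if c$1 = 0 then (0,1) else if c$1 = 1 then (2,1) else if c$2 = 0 then (1,0) else (1,2))"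
  have d: "d \<in> digits" by (auto simp: d_def digits_def)
  have "cell_coord d (cell_map (1,1) c) \<in> square_boundary"
    using c by (auto simp: d_def square_boundary_def mem_unit_square)
  then show ?thesis
    using cell_map_carpet[OF d] boundary_subset_carpet cell_map_coord(1) by (metis subsetD)
qed

text \<open>An open cell meets no other closed cell, so at every stage a carpet point in the open cell
\<open>d\<close> comes from the copy of the previous stage in \<open>d\<close>.\<close>

lemma carpet_in_open_cell:
  assumes a: "a \<in> sierpinski_carpet"
    and int: "cell_coord d a \<in> unit_square - square_boundary"
  shows "d \<in> digits \<and> cell_coord d a \<in> sierpinski_carpet"
proof -
  have *: "d \<in> digits \<and> cell_coord d a \<in> carpet_stage n" for n
  proof -
    have "a \<in> carpet_stage (Suc n)" using a by (auto simp: sierpinski_carpet_def)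
    then obtain e y where e: "e \<in> digits" and y: "y \<in> carpet_stage n" and ay: "a = cell_map e y"
      by (auto simp: stage_Suc)
    have y': "y \<in> unit_square" using y stage_subset by blast
    have "real (fst e) < fst d + 1" "real (fst d) < fst e + 1"
        "real (snd e) < snd d + 1" "real (snd d) < snd e + 1"
      using y' int unfolding ay square_boundary_def by (auto simp: mem_unit_square)
    then have "e = d" by (auto simp: prod_eq_iff)
    then show ?thesis using e y ay by simp
  qed
  then show ?thesis by (auto simp: sierpinski_carpet_def)
qed

lemma carpet_nonempty [simp]: "sierpinski_carpet \<noteq> {}"
proof -
  have "0 \<in> square_boundary" by (simp add: square_boundary_def mem_unit_square)
  then show ?thesis using boundary_subset_carpet by blast
qed

lemma le_infdist_iff: "A \<noteq> {} \<Longrightarrow> t \<le> infdist x A \<longleftrightarrow> (\<forall>a\<in>A. t \<le> dist x a)"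
  by (auto simp: infdist_def intro!: le_cINF_iff bdd_belowI2[of _ 0])

lemma dist_component_le: "\<bar>(x::real^2)$i - (y::real^2)$i\<bar> \<le> dist x y"
  by (metis component_le_norm_cart dist_norm vector_minus_component)

lemma dist_horizontal: "(x::real^2)$2 = (y::real^2)$2 \<Longrightarrow> dist x y = \<bar>x$1 - y$1\<bar>"
  by (simp add: dist_norm norm_vec_def L2_set_def UNIV_2)

lemma dist_vertical: "(x::real^2)$1 = (y::real^2)$1 \<Longrightarrow> dist x y = \<bar>x$2 - y$2\<bar>"
  by (simp add: dist_norm norm_vec_def L2_set_def UNIV_2)

text \<open>Moving one coordinate of \<open>y\<close> to the side of the square beyond which \<open>b\<close>
lies gives a boundary point at most as far from \<open>y\<close> as \<open>b\<close>. Hence carpet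
points outside the open square never matter for distances from points inside it.\<close>

lemma square_exit:
  assumes y: "y \<in> unit_square" and b: "b \<notin> unit_square - square_boundary"
  shows "\<exists>c\<in>square_boundary. dist y c \<le> dist y b"
proof -
  have y': "0 \<le> y$1" "y$1 \<le> 1" "0 \<le> y$2" "y$2 \<le> 1" using y by (auto simp: mem_unit_square)
  have horiz: ?thesis if "r = 0 \<and> b$1 \<le> 0 \<or> r = 1 \<and> b$1 \<ge> 1" for r :: real
  proof
    show "vector [r, y$2] \<in> square_boundary"
      using that y' by (auto simp: square_boundary_def mem_unit_square)
    have "dist y (vector [r, y$2]) = \<bar>y$1 - r\<bar>" by (simp add: dist_horizontal)
    also have "\<dots> \<le> \<bar>y$1 - b$1\<bar>" using that y' by auto
    finally show "dist y (vector [r, y$2]) \<le> dist y b" using dist_component_le[of y 1 b] by simp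
  qed
  have vert: ?thesis if "r = 0 \<and> b$2 \<le> 0 \<or> r = 1 \<and> b$2 \<ge> 1" for r :: real
  proof
    show "vector [y$1, r] \<in> square_boundary"
      using that y' by (auto simp: square_boundary_def mem_unit_square)
    have "dist y (vector [y$1, r]) = \<bar>y$2 - r\<bar>" by (simp add: dist_vertical)
    also have "\<dots> \<le> \<bar>y$2 - b$2\<bar>" using that y' by auto
    finally show "dist y (vector [y$1, r]) \<le> dist y b" using dist_component_le[of y 2 b] by simp
  qed
  have "b$1 \<le> 0 \<or> b$1 \<ge> 1 \<or> b$2 \<le> 0 \<or> b$2 \<ge> 1"
    using b by (auto simp: square_boundary_def mem_unit_square)
  then show ?thesis using horiz vert by blast
qed

lemma dist_cell_map: "dist (cell_map d x) (cell_map d y) = dist x y / 3"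
proof -
  have "cell_map d x - cell_map d y = (1/3) *\<^sub>R (x - y)"
    by (simp add: cell_map_def algebra_simps)
  then show ?thesis by (simp add: dist_norm)
qed

text \<open>Within a kept cell the carpet looks like the whole carpet scaled by 1/3: carpet points outside the
open cell are no closer than the boundary of the cell, which is part of the copy.\<close>

lemma infdist_carpet_cell:
  assumes d: "d \<in> digits" and y: "y \<in> unit_square"
  shows "t \<le> infdist (cell_map d y) sierpinski_carpet \<longleftrightarrow> 3 * t \<le> infdist y sierpinski_carpet"
proof
  assume L: "t \<le> infdist (cell_map d y) sierpinski_carpet"
  show "3 * t \<le> infdist y sierpinski_carpet"
    unfolding le_infdist_iff[OF carpet_nonempty]
  proof
    fix a assume "a \<in> sierpinski_carpet"
    then have "t \<le> dist (cell_map d y) (cell_map d a)"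
      using L cell_map_carpet[OF d] by (auto simp: le_infdist_iff)
    then show "3 * t \<le> dist y a" by (simp add: dist_cell_map)
  qed
next
  assume R: "3 * t \<le> infdist y sierpinski_carpet"
  show "t \<le> infdist (cell_map d y) sierpinski_carpet"
    unfolding le_infdist_iff[OF carpet_nonempty]
  proof
    fix a assume a: "a \<in> sierpinski_carpet"
    have "3 * t \<le> dist y (cell_coord d a)"
    proof (cases "cell_coord d a \<in> unit_square - square_boundary")
      case True
      then show ?thesis using carpet_in_open_cell[OF a] R by (auto simp: le_infdist_iff)
    next
      case False
      then obtain c where "c \<in> square_boundary" "dist y c \<le> dist y (cell_coord d a)"
        using square_exit[OF y] by blast
      then show ?thesis using R boundary_subset_carpet by (force simp: le_infdist_iff)
    qed
    then show "t \<le> dist (cell_map d y) a"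
      using dist_cell_map[of d y "cell_coord d a"] by simp
  qed
qed

text \<open>In the hole the nearest carpet points are on the four sides, straight ahead along an axis.\<close>

lemma infdist_carpet_hole:
  assumes t: "0 < t" and y: "y \<in> unit_square"
  shows "t \<le> infdist (cell_map (1,1) y) sierpinski_carpet \<longleftrightarrow>
    cell_map (1,1) y \<in> cbox (vector [1/3 + t, 1/3 + t]) (vector [2/3 - t, 2/3 - t])"
    (is "_ \<le> infdist ?x _ \<longleftrightarrow> _")
proof
  assume L: "t \<le> infdist ?x sierpinski_carpet"
  have y': "0 \<le> y$1" "y$1 \<le> 1" "0 \<le> y$2" "y$2 \<le> 1" using y by (auto simp: mem_unit_square)
  have *: "t \<le> dist y c / 3" if "c \<in> square_boundary" for c
    using L hole_boundary_carpet[OF that] dist_cell_map[of "(1,1)" y c] by (auto simp: le_infdist_iff)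
  have h: "t \<le> \<bar>y$1 - r\<bar> / 3" if "r = 0 \<or> r = 1" for r
    using *[of "vector [r, y$2]"] that y'
    by (auto simp: dist_horizontal square_boundary_def mem_unit_square)
  have v: "t \<le> \<bar>y$2 - r\<bar> / 3" if "r = 0 \<or> r = 1" for r
    using *[of "vector [y$1, r]"] that y'
    by (auto simp: dist_vertical square_boundary_def mem_unit_square)
  show "?x \<in> cbox (vector [1/3 + t, 1/3 + t]) (vector [2/3 - t, 2/3 - t])"
    using h[of 0] h[of 1] v[of 0] v[of 1] y' by (auto simp: mem_box_cart forall_2)
next
  assume R: "?x \<in> cbox (vector [1/3 + t, 1/3 + t]) (vector [2/3 - t, 2/3 - t])"
  show "t \<le> infdist ?x sierpinski_carpet"
    unfolding le_infdist_iff[OF carpet_nonempty]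
  proof
    fix a assume a: "a \<in> sierpinski_carpet"
    have "cell_coord (1,1) a \<notin> unit_square - square_boundary"
      using carpet_in_open_cell[OF a, of "(1,1)"] by (auto simp: digits_def)
    then have "a$1 \<le> 1/3 \<or> a$1 \<ge> 2/3 \<or> a$2 \<le> 1/3 \<or> a$2 \<ge> 2/3"
      by (auto simp: square_boundary_def mem_unit_square)
    then have "t \<le> \<bar>?x$1 - a$1\<bar> \<or> t \<le> \<bar>?x$2 - a$2\<bar>"
      using R by (auto simp: mem_box_cart forall_2)
    then show "t \<le> dist ?x a" using dist_component_le[of ?x 1 a] dist_component_le[of ?x 2 a] by linarith
  qed
qed

section \<open>The area far from the carpet inside the unit square\<close>

definition far_set :: "real \<Rightarrow> (real^2) set" where
  "far_set t = {x \<in> unit_square. t \<le> infdist x sierpinski_carpet}"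

lemma far_set_not_boundary: "0 < t \<Longrightarrow> x \<in> far_set t \<Longrightarrow> x \<notin> square_boundary"
  using boundary_subset_carpet by (auto simp: far_set_def)

lemma far_set_decomp:
  assumes t: "0 < t"
  shows "far_set t = (\<Union>d\<in>digits. cell_map d ` far_set (3 * t)) \<union>
    cbox (vector [1/3 + t, 1/3 + t]) (vector [2/3 - t, 2/3 - t])" (is "_ = ?C \<union> ?H")
proof (intro set_eqI iffI)
  fix x assume x: "x \<in> far_set t"
  then have x': "0 \<le> x$1" "x$1 \<le> 1" "0 \<le> x$2" "x$2 \<le> 1" and xt: "t \<le> infdist x sierpinski_carpet"
    by (auto simp: far_set_def mem_unit_square)
  obtain i :: nat where i: "i \<in> {0,1,2}" "0 \<le> 3 * x$1 - i" "3 * x$1 - i \<le> 1"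
    using third_digit x' by metis
  obtain j :: nat where j: "j \<in> {0,1,2}" "0 \<le> 3 * x$2 - j" "3 * x$2 - j \<le> 1"
    using third_digit x' by metis
  have y: "cell_coord (i,j) x \<in> unit_square" using i j by (auto simp: mem_unit_square)
  show "x \<in> ?C \<union> ?H"
  proof (cases "(i,j) = (1,1)")
    case True
    then show ?thesis using infdist_carpet_hole[OF t y] xt by auto
  next
    case False
    then have d: "(i,j) \<in> digits" using i j by (auto simp: digits_def)
    then have "cell_coord (i,j) x \<in> far_set (3 * t)"
      using infdist_carpet_cell[OF d y] xt y by (auto simp: far_set_def)
    then show ?thesis using d cell_map_coord(1) by (metis UN_I UnI1 image_eqI)
  qed
next
  fix x assume "x \<in> ?C \<union> ?H"
  then show "x \<in> far_set t"
  proof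
    assume "x \<in> ?C"
    then show ?thesis
      using infdist_carpet_cell cell_map_unit_square by (auto simp: far_set_def)
  next
    assume x: "x \<in> ?H"
    then have y: "cell_coord (1,1) x \<in> unit_square" and "x \<in> unit_square"
      using t by (auto simp: mem_unit_square mem_box_cart forall_2)
    then show ?thesis using infdist_carpet_hole[OF t y] x by (auto simp: far_set_def)
  qed
qed

lemma far_set_compact: "compact (far_set t)"
proof -
  have "far_set t = unit_square \<inter> {x. t \<le> infdist x sierpinski_carpet}"
    by (auto simp: far_set_def)
  moreover have "closed {x. t \<le> infdist x sierpinski_carpet}"
    by (intro closed_Collect_le continuous_intros)
  ultimately show ?thesis by (simp add: compact_Int_closed unit_square_def)
qed

lemma far_set_empty:
  assumes "1/2 < t"
  shows "far_set t = {}"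
proof (rule equals0I)
  fix x assume x: "x \<in> far_set t"
  then have x': "0 \<le> x$1" "x$1 \<le> 1" "0 \<le> x$2" "x$2 \<le> 1" and xt: "t \<le> infdist x sierpinski_carpet"
    by (auto simp: far_set_def mem_unit_square)
  have "t \<le> dist x (vector [r, x$2])" if "r = 0 \<or> r = 1" for r
  proof -
    have "vector [r, x$2] \<in> square_boundary"
      using that x' by (auto simp: square_boundary_def mem_unit_square)
    then show ?thesis using xt boundary_subset_carpet by (auto simp: le_infdist_iff)
  qed
  from this[of 0] this[of 1] show False using assms x' by (auto simp: dist_horizontal)
qed

lemma measure_cell_map: "S \<in> sets lebesgue \<Longrightarrow> measure lebesgue (cell_map d ` S) = measure lebesgue S / 9"
  using measure_lebesgue_affine[of "1/3" "(1/3) *\<^sub>R vector [real (fst d), real (snd d)]" S]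
  by (simp add: cell_map_def[abs_def] add.commute power2_eq_square)

lemma measure_square: "measure lebesgue (cbox (vector [a, a] :: real^2) (vector [b, b])) = (max 0 (b - a))\<^sup>2"
proof -
  have "cbox (vector [a, a] :: real^2) (vector [b, b]) = {} \<longleftrightarrow> b < a"
    using interval_ne_empty_cart(1)[of "vector [a, a] :: real^2" "vector [b, b]"] by (auto simp: forall_2)
  then show ?thesis
    by (auto simp: content_cbox_if_cart power2_eq_square UNIV_2)
qed

text \<open>For \<open>t > 0\<close> the far sets of the cells avoid the boundaries of the cells, so the
decomposition of the far set is disjoint and areas add up.\<close>

lemma far_measure_self_similar:
  assumes t: "0 < t"
  shows "measure lebesgue (far_set t) = 8/9 * measure lebesgue (far_set (3 * t)) + (max 0 (1/3 - 2 * t))\<^sup>2"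
proof -
  let ?H = "cbox (vector [1/3 + t, 1/3 + t]) (vector [2/3 - t, 2/3 - t]) :: (real^2) set"
  let ?G = "\<lambda>d. cell_map d ` far_set (3 * t)"
  have lm: "?G d \<in> lmeasurable" for d
  proof (rule lmeasurable_compact)
    have "continuous_on (far_set (3 * t)) (cell_map d)"
      unfolding cell_map_def by (intro continuous_intros)
    then show "compact (?G d)" by (rule compact_continuous_image) (rule far_set_compact)
  qed
  have int: "0 < y$1 \<and> y$1 < 1 \<and> 0 < y$2 \<and> y$2 < 1" if "y \<in> far_set (3 * t)" for y :: "real^2"
    using far_set_not_boundary[OF _ that] t that
    by (auto simp: far_set_def square_boundary_def mem_unit_square less_le)
  \<comment> \<open>An inner point of a cell lies in no other closed cell.\<close>
  have loc: "d = e" if "y \<in> far_set (3 * t)" "z \<in> unit_square" "cell_map d y = cell_map e z" for d e and y z :: "real^2"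
  proof -
    have "y$1 + fst d = z$1 + fst e" "y$2 + snd d = z$2 + snd e"
      using that(3) by (auto simp: real2_eq_iff)
    then have "real (fst e) < fst d + 1" "real (fst d) < fst e + 1"
        "real (snd e) < snd d + 1" "real (snd d) < snd e + 1"
      using int[OF that(1)] that(2) by (auto simp: mem_unit_square)
    then show ?thesis by (auto simp: prod_eq_iff)
  qed
  have disj: "disjoint_family_on ?G digits"
    unfolding disjoint_family_on_def using loc by (fastforce simp: far_set_def)
  have disj2: "(\<Union>d\<in>digits. ?G d) \<inter> ?H = {}"
  proof -
    have False if "d \<in> digits" "y \<in> far_set (3*t)" "cell_map d y \<in> ?H" for d y
    proof -
      have "d = (1,1)"
        using that by (intro loc[OF that(2), of "cell_coord (1,1) (cell_map d y)"])
          (use t in \<open>auto simp: mem_box_cart forall_2 mem_unit_square\<close>)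
      then show False using that by (simp add: digits_def)
    qed
    then show ?thesis by blast
  qed
  have "measure lebesgue (far_set t) = measure lebesgue (\<Union>d\<in>digits. ?G d) + measure lebesgue ?H"
    unfolding far_set_decomp[OF t]
    by (subst measure_Un3) (auto simp: disj2 intro!: fmeasurable.finite_UN lm)
  also have "measure lebesgue (\<Union>d\<in>digits. ?G d) = (\<Sum>d\<in>digits. measure lebesgue (?G d))"
    by (intro measure_finite_Union disj finite_digits)
      (use fmeasurableD[OF lm] fmeasurableD2[OF lm, folded infinity_ennreal_def] in blast)+
  also have "\<dots> = 8/9 * measure lebesgue (far_set (3 * t))"
    by (simp add: measure_cell_map card_digits lmeasurable_compact far_set_compact fmeasurableD)
  finally show ?thesis by (simp add: measure_square)
qed

lemma far_measure_iterate:
  assumes t: "0 < t"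
  shows "measure lebesgue (far_set t) =
    (\<Sum>k<n. 8 ^ k * (max 0 (1 / 3 ^ Suc k - 2 * t))\<^sup>2) + (8/9) ^ n * measure lebesgue (far_set (3 ^ n * t))"
proof (induction n)
  case (Suc n)
  have "max 0 (1/3 - 2 * (3 ^ n * t)) = 3 ^ n * max 0 (1 / 3 ^ Suc n - 2 * t)"
    by (simp add: max_def field_simps)
  then have "(8/9) ^ n * (max 0 (1/3 - 2 * (3 ^ n * t)))\<^sup>2 = 8 ^ n * (max 0 (1 / 3 ^ Suc n - 2 * t))\<^sup>2"
    by (simp add: power_mult_distrib power_divide flip: power_mult power2_eq_square power_mult[of 3 2 n])
      (simp add: power_mult mult.commute[of n 2])
  then show ?case
    using Suc.IH far_measure_self_similar[of "3 ^ n * t"] t by (simp add: algebra_simps)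
qed simp

text \<open>The remainder of the iterated recursion vanishes once \<open>3 ^ n * t > 1/2\<close>, since no
point of the square is farther than 1/2 from its boundary.\<close>

lemma far_measure_sums:
  assumes t: "0 < t"
  shows "(\<lambda>k. 8 ^ k * (max 0 (1 / 3 ^ Suc k - 2 * t))\<^sup>2) sums measure lebesgue (far_set t)"
proof -
  obtain n where "1 / t < 3 ^ n" using real_arch_pow[of 3 "1/t"] by auto
  then have n: "1 < 3 ^ n * t" using t by (simp add: field_simps)
  have "measure lebesgue (far_set t) = (\<Sum>k<m. 8 ^ k * (max 0 (1 / 3 ^ Suc k - 2 * t))\<^sup>2)" if "m \<ge> n" for m
  proof -
    have "3 ^ n * t \<le> 3 ^ m * t" using that t by (intro mult_right_mono power_increasing) auto
    then have "far_set (3 ^ m * t) = {}" using n by (intro far_set_empty) simp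
    then show ?thesis using far_measure_iterate[OF t, of m] by simp
  qed
  then show ?thesis unfolding sums_def
    by (intro tendsto_eventually) (metis (mono_tags, lifting) eventually_sequentially)
qed

text \<open>The distance of \<open>y\<close> from the interval \<open>{0..1}\<close>.\<close>

section \<open>The area of the neighbourhoods of the carpet\<close>

definition excess :: "real \<Rightarrow> real" where
  "excess y = max 0 (max (- y) (y - 1))"

lemma dist_real2: "dist (x::real^2) y = sqrt ((x$1 - (y::real^2)$1)\<^sup>2 + (x$2 - y$2)\<^sup>2)"
  by (simp add: dist_norm norm_vec_def L2_set_def UNIV_2)

text \<open>The point of the unit square closest to an outside point lies on the boundary of the square, hence
in the carpet.\<close>

lemma infdist_carpet_outside:
  assumes x: "x \<notin> unit_square"
  shows "infdist x sierpinski_carpet = sqrt ((excess (x$1))\<^sup>2 + (excess (x$2))\<^sup>2)" (is "_ = ?r")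
proof (rule antisym)
  \<comment> \<open>The closest point of the square.\<close>
  define c :: "real^2" where "c = vector [max 0 (min 1 (x$1)), max 0 (min 1 (x$2))]"
  have "c \<in> square_boundary"
    using x by (auto simp: c_def square_boundary_def mem_unit_square max_def min_def)
  then have "infdist x sierpinski_carpet \<le> dist x c"
    using boundary_subset_carpet by (intro infdist_le) auto
  also have "\<bar>y - max 0 (min 1 y)\<bar> = excess y" for y
    by (auto simp: excess_def max_def min_def)
  then have "(y - max 0 (min 1 y))\<^sup>2 = (excess y)\<^sup>2" for y
    by (metis power2_abs)
  then have "dist x c = ?r" by (simp add: dist_real2 c_def)
  finally show "infdist x sierpinski_carpet \<le> ?r" .
  show "?r \<le> infdist x sierpinski_carpet"
    unfolding le_infdist_iff[OF carpet_nonempty]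
  proof
    fix a assume "a \<in> sierpinski_carpet"
    then have "a \<in> unit_square" using carpet_subset by blast
    then have "excess (x$1) \<le> \<bar>x$1 - a$1\<bar>" "excess (x$2) \<le> \<bar>x$2 - a$2\<bar>"
      by (auto simp: excess_def mem_unit_square)
    moreover have "0 \<le> excess y" for y by (simp add: excess_def)
    ultimately show "?r \<le> dist x a"
      unfolding dist_real2
      by (intro real_sqrt_le_mono add_mono) (metis power2_abs power_mono)+
  qed
qed

lemma nbhd_carpet_decomp:
  assumes t: "0 < t"
  shows "nbhd sierpinski_carpet t = {x. (excess (x$1))\<^sup>2 + (excess (x$2))\<^sup>2 < t\<^sup>2} - far_set t"
    and "far_set t \<subseteq> {x. (excess (x$1))\<^sup>2 + (excess (x$2))\<^sup>2 < t\<^sup>2}"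
proof -
  have in_sq: "excess (x$1) = 0 \<and> excess (x$2) = 0" if "x \<in> unit_square" for x :: "real^2"
    using that by (auto simp: excess_def mem_unit_square)
  show "far_set t \<subseteq> {x. (excess (x$1))\<^sup>2 + (excess (x$2))\<^sup>2 < t\<^sup>2}"
    using t in_sq by (auto simp: far_set_def)
  have sqrt_less: "sqrt z < t \<longleftrightarrow> z < t\<^sup>2" for z
    using t real_sqrt_less_iff[of z "t\<^sup>2"] by simp
  have "infdist x sierpinski_carpet < t \<longleftrightarrow>
      (excess (x$1))\<^sup>2 + (excess (x$2))\<^sup>2 < t\<^sup>2 \<and> x \<notin> far_set t" for x
  proof (cases "x \<in> unit_square")
    case True
    then show ?thesis using t in_sq[OF True] by (auto simp: far_set_def)
  next
    case False
    then show ?thesis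
      unfolding infdist_carpet_outside[OF False] sqrt_less by (simp add: far_set_def)
  qed
  then show "nbhd sierpinski_carpet t = {x. (excess (x$1))\<^sup>2 + (excess (x$2))\<^sup>2 < t\<^sup>2} - far_set t"
    by (auto simp: nbhd_def)
qed

text \<open>The part of the line before, inside or after the unit interval, for \<open>p = -1, 0, 1\<close>.\<close>

definition side_interval :: "int \<Rightarrow> real set" where
  "side_interval p = (if p < 0 then {..<0} else if p = 0 then {0..1} else {1<..})"

lemma measure_between_boxes:
  fixes u v :: "'a::euclidean_space"
  assumes "box u v \<subseteq> W" "W \<subseteq> cbox u v"
  shows "W \<in> lmeasurable" "measure lebesgue W = measure lebesgue (cbox u v)"
proof -
  have neg: "negligible (cbox u v - W \<union> (W - cbox u v))"
    by (rule negligible_subset[OF negligible_frontier_interval[of u v]]) (use assms in auto)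
  show "W \<in> lmeasurable" "measure lebesgue W = measure lebesgue (cbox u v)"
    using measure_negligible_symdiff[OF _ neg] lmeasurable_negligible_symdiff[OF _ neg] by simp_all
qed

lemma content_rectangle:
  "a \<le> b \<Longrightarrow> c \<le> d \<Longrightarrow> measure lebesgue (cbox (vector [a, c] :: real^2) (vector [b, d])) = (b - a) * (d - c)"
  using content_cbox_cart[of "vector [a, c] :: real^2" "vector [b, d]"]
    interval_ne_empty_cart(1)[of "vector [a, c] :: real^2" "vector [b, d]"]
  by (simp add: forall_2 UNIV_2)

text \<open>The corner regions of the neighbourhood of the square are quarter discs; they are measured
together because, moved to the origin, they fill a disc up to the two axes.\<close>

lemma measure_quadrants:
  assumes t: "0 < t"
  defines "Q \<equiv> \<lambda>(p::int, q::int). {x::real^2. 0 < of_int p * x$1 \<and> 0 < of_int q * x$2 \<and> (x$1)\<^sup>2 + (x$2)\<^sup>2 < t\<^sup>2}"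
  shows "(\<Sum>d\<in>{-1,1}\<times>{-1,1}. measure lebesgue (Q d)) = pi * t\<^sup>2"
    and "\<And>d. Q d \<in> lmeasurable"
proof -
  have ball: "ball (0::real^2) t = {x. (x$1)\<^sup>2 + (x$2)\<^sup>2 < t\<^sup>2}"
  proof -
    have "sqrt z < t \<longleftrightarrow> z < t\<^sup>2" for z
      using t real_sqrt_less_iff[of z "t\<^sup>2"] by simp
    then show ?thesis by (auto simp: ball_def dist_real2)
  qed
  show lm: "Q d \<in> lmeasurable" for d
  proof (cases d)
    case (Pair p q)
    have "Q d = {x. 0 < of_int p * x$1} \<inter> {x. 0 < of_int q * x$2} \<inter> ball 0 t"
      by (auto simp: Pair Q_def ball)
    moreover have "open {x::real^2. 0 < of_int p * x$1}" "open {x::real^2. 0 < of_int q * x$2}"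
      by (intro open_Collect_less continuous_intros)+
    ultimately show ?thesis
      by (intro lmeasurable_open) (auto intro: bounded_subset[OF bounded_ball])
  qed
  have "disjoint_family_on Q ({-1,1}\<times>{-1,1})"
    by (auto simp: disjoint_family_on_def Q_def)
  then have "(\<Sum>d\<in>{-1,1}\<times>{-1,1}. measure lebesgue (Q d)) = measure lebesgue (\<Union>d\<in>{-1,1}\<times>{-1,1}. Q d)"
    by (intro measure_finite_Union[symmetric])
      (use fmeasurableD[OF lm] fmeasurableD2[OF lm, folded infinity_ennreal_def] in blast)+
  also have "\<dots> = measure lebesgue (ball (0::real^2) t)"
  proof (rule measure_negligible_symdiff)
    show "ball (0::real^2) t \<in> lmeasurable" by simp
    have "negligible ({x::real^2. x$1 = 0} \<union> {x. x$2 = 0})"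
      by (intro negligible_Un negligible_standard_hyperplane_cart)
    then show "negligible (ball 0 t - (\<Union>d\<in>{-1,1}\<times>{-1,1}. Q d) \<union> ((\<Union>d\<in>{-1,1}\<times>{-1,1}. Q d) - ball 0 t))"
      by (rule negligible_subset) (auto simp: ball Q_def)
  qed
  also have "\<dots> = pi * t\<^sup>2" using t by (simp add: content_ball unit_ball_vol_2)
  finally show "(\<Sum>d\<in>{-1,1}\<times>{-1,1}. measure lebesgue (Q d)) = pi * t\<^sup>2" .
qed

text \<open>Steiner's formula for the unit square. The lines that carry the sides cut the neighbourhood into
the square, four rectangles of area \<open>t\<close> and four quarter discs.\<close>

lemma measure_square_nbhd:
  assumes t: "0 < t"
  shows "measure lebesgue {x::real^2. (excess (x$1))\<^sup>2 + (excess (x$2))\<^sup>2 < t\<^sup>2} = 1 + 4 * t + pi * t\<^sup>2"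
    and "{x::real^2. (excess (x$1))\<^sup>2 + (excess (x$2))\<^sup>2 < t\<^sup>2} \<in> lmeasurable" (is "?N \<in> _")
proof -
  define W :: "int \<times> int \<Rightarrow> (real^2) set" where
    "W = (\<lambda>(p, q). {x \<in> ?N. x$1 \<in> side_interval p \<and> x$2 \<in> side_interval q})"
  define Q where "Q = (\<lambda>(p::int, q::int). {x::real^2. 0 < of_int p * x$1 \<and> 0 < of_int q * x$2 \<and> (x$1)\<^sup>2 + (x$2)\<^sup>2 < t\<^sup>2})"
  note quad = measure_quadrants[OF t, folded Q_def]
  have sq: "y\<^sup>2 < t\<^sup>2 \<longleftrightarrow> \<bar>y\<bar> < t" for y
    using t abs_le_square_iff[of t y] by auto
  have mid: "W (0,0) = unit_square"
    using t by (auto simp: W_def side_interval_def mem_unit_square excess_def)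
  have ex: "excess y = (if y < 0 then - y else if y \<le> 1 then 0 else y - 1)" for y
    by (auto simp: excess_def)
  have rect: "box (vector [a, c]) (vector [b, d]) \<subseteq> W (p, q) \<and> W (p, q) \<subseteq> cbox (vector [a, c]) (vector [b, d])"
    if "(p, q, a, b, c, d) \<in> {(-1, 0, -t, 0, 0, 1), (1, 0, 1, 1 + t, 0, 1), (0, -1, 0, 1, -t, 0), (0, 1, 0, 1, 1, 1 + t)}"
    for p q a b c d
    using that t
    by (auto simp: W_def side_interval_def mem_box_cart forall_2 ex sq split: if_splits)
  have rects: "W d \<in> lmeasurable" "measure lebesgue (W d) = t" if "d \<in> {(-1,0),(1,0),(0,-1),(0,1)}" for d
  proof -
    obtain a b c e where "(fst d, snd d, a, b, c, e) \<in> {(-1, 0, -t, 0, 0, 1), (1, 0, 1, 1 + t, 0, 1), (0, -1, 0, 1, -t, 0), (0, 1, 0, 1, 1, 1 + t)}"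
      "(b - a) * (e - c) = t" "a \<le> b" "c \<le> e"
      using t \<open>d \<in> _\<close> by fastforce
    then show "W d \<in> lmeasurable" "measure lebesgue (W d) = t"
      using rect[of "fst d" "snd d" a b c e] measure_between_boxes[of _ _ "W d"] content_rectangle[of a b c e]
      by auto
  qed
  have corner: "W (p, q) = (+) (vector [(1 + of_int p) / 2, (1 + of_int q) / 2]) ` Q (p, q)"
    if "(p, q) \<in> {-1,1}\<times>{-1,1}" for p q
  proof -
    define v :: "real^2" where "v = vector [(1 + of_int p) / 2, (1 + of_int q) / 2]"
    have "x \<in> W (p, q) \<longleftrightarrow> x - v \<in> Q (p, q)" for x
      using that by (auto simp: W_def Q_def v_def side_interval_def ex power2_commute)
    then show ?thesis
      unfolding v_def[symmetric] by (force simp: image_iff intro: bexI[of _ "_ - v"])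
  qed
  have corners: "W d \<in> lmeasurable" "measure lebesgue (W d) = measure lebesgue (Q d)" if "d \<in> {-1,1}\<times>{-1,1}" for d
    using corner[of "fst d" "snd d"] that quad(2)[of d] by (auto simp: measurable_translation measure_translation)
  have lm: "W d \<in> lmeasurable" if "d \<in> {-1,0,1} \<times> {-1,0,1}" for d
    using that rects(1) corners(1) mid by (auto simp: unit_square_def)
  have N: "?N = (\<Union>d\<in>{-1,0,1} \<times> {-1,0,1}. W d)"
  proof -
    have "\<exists>p\<in>{-1,0,1}. y \<in> side_interval p" for y :: real
      by (auto simp: side_interval_def)
    then have "\<exists>d\<in>{-1,0,1} \<times> {-1,0,1}. x$1 \<in> side_interval (fst d) \<and> x$2 \<in> side_interval (snd d)" for x :: "real^2"
      by (metis SigmaI fst_conv snd_conv)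
    then show ?thesis by (fastforce simp: W_def)
  qed
  show "?N \<in> lmeasurable"
    unfolding N by (intro fmeasurable.finite_UN lm) auto
  have "disjoint_family_on W ({-1,0,1} \<times> {-1,0,1})"
  proof -
    have disj: "side_interval p \<inter> side_interval q = {}" if "p \<noteq> q" "p \<in> {-1,0,1}" "q \<in> {-1,0,1}" for p q
      using that by (auto simp: side_interval_def)
    have disjW: "W d \<inter> W e = {}" if "d \<noteq> e" "d \<in> {-1,0,1} \<times> {-1,0,1}" "e \<in> {-1,0,1} \<times> {-1,0,1}" for d e
    proof (cases "fst d = fst e")
      case True
      then have "side_interval (snd d) \<inter> side_interval (snd e) = {}"
        using that disj[of "snd d" "snd e"] by (metis mem_Times_iff prod_eqI)
      then show ?thesis unfolding W_def case_prod_beta by blast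
    next
      case False
      then have "side_interval (fst d) \<inter> side_interval (fst e) = {}"
        using that disj[of "fst d" "fst e"] by (metis mem_Times_iff)
      then show ?thesis unfolding W_def case_prod_beta by blast
    qed
    show ?thesis
      unfolding disjoint_family_on_def by (intro ballI impI disjW)
  qed
  then have "measure lebesgue ?N = (\<Sum>d\<in>{-1,0,1} \<times> {-1,0,1}. measure lebesgue (W d))"
    unfolding N
    by (intro measure_finite_Union)
      (use fmeasurableD[OF lm] fmeasurableD2[OF lm, folded infinity_ennreal_def] in blast)+
  also have "{-1,0,1} \<times> {-1,0,1::int} = insert (0,0) ({(-1,0),(1,0),(0,-1),(0,1)} \<union> {-1,1}\<times>{-1,1::int})"
    by auto
  also have "(\<Sum>d\<in>\<dots>. measure lebesgue (W d)) =
      measure lebesgue (W (0,0)) + (\<Sum>d\<in>{(-1,0),(1,0),(0,-1),(0,1)}. measure lebesgue (W d)) +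
      (\<Sum>d\<in>{-1,1}\<times>{-1,1}. measure lebesgue (W d))"
    by (subst sum.insert, simp, simp, subst sum.union_disjoint) auto
  also have "measure lebesgue (W (0,0)) = 1"
  proof -
    have eq: "unit_square = cbox (vector [0, 0]) (vector [1, 1])"
      by (auto simp: mem_unit_square mem_box_cart forall_2)
    show ?thesis unfolding mid eq by (subst content_rectangle) auto
  qed
  also have "(\<Sum>d\<in>{(-1,0),(1,0),(0,-1),(0,1)}. measure lebesgue (W d)) = (\<Sum>d\<in>{(-1,0),(1,0),(0,-1),(0,1::int)::int\<times>int}. t)"
    by (intro sum.cong refl rects(2))
  also have "\<dots> = 4 * t" by simp
  also have "(\<Sum>d\<in>{-1,1}\<times>{-1,1}. measure lebesgue (W d)) = pi * t\<^sup>2"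
    using corners(2) quad(1) by (metis (mono_tags, lifting) sum.cong)
  finally show "measure lebesgue ?N = 1 + 4 * t + pi * t\<^sup>2" .
qed

theorem carpet_nbhd_measure:
  assumes t: "0 < t"
  shows "nbhd sierpinski_carpet t \<in> lmeasurable"
    and "(\<lambda>k. 8 ^ k * (max 0 (1 / 3 ^ Suc k - 2 * t))\<^sup>2) sums
      (1 + 4 * t + pi * t\<^sup>2 - measure lebesgue (nbhd sierpinski_carpet t))"
proof -
  note N = measure_square_nbhd[OF t] and dec = nbhd_carpet_decomp[OF t]
  have F: "far_set t \<in> lmeasurable" by (intro lmeasurable_compact far_set_compact)
  show "nbhd sierpinski_carpet t \<in> lmeasurable"
    unfolding dec(1) by (intro fmeasurable.Diff N F)
  have "measure lebesgue (nbhd sierpinski_carpet t) = 1 + 4 * t + pi * t\<^sup>2 - measure lebesgue (far_set t)"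
    unfolding dec(1) using N F dec(2) by (subst measurable_measure_Diff) (auto intro: fmeasurableD)
  then show "(\<lambda>k. 8 ^ k * (max 0 (1 / 3 ^ Suc k - 2 * t))\<^sup>2) sums
      (1 + 4 * t + pi * t\<^sup>2 - measure lebesgue (nbhd sierpinski_carpet t))"
    using far_measure_sums[OF t] by simp
qed

text \<open>The square removes the corner of \<open>max 0 t\<close>, so the area of a shrinking hole can be
differentiated across the radius at which it vanishes.\<close>

section \<open>The distribution of the distance to the carpet\<close>

lemma has_field_derivative_max_sq:
  "((\<lambda>t. (max 0 t)\<^sup>2) has_field_derivative 2 * max 0 t) (at (t::real))"
proof -
  consider "t < 0" | "t = 0" | "t > 0" by linarith
  then show ?thesis
  proof cases
    case 1
    have "((\<lambda>t. 0) has_field_derivative 2 * max 0 t) (at t)" using 1 by (simp add: max_def)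
    then show ?thesis
      by (rule has_field_derivative_transform_within_open[of _ _ _ "{..<0}"]) (use 1 in auto)
  next
    case 2
    have "((\<lambda>h::real. (max 0 h)\<^sup>2 / h) \<longlongrightarrow> 0) (at 0)"
    proof (rule tendsto_rabs_zero_cancel, rule real_tendsto_sandwich)
      show "\<forall>\<^sub>F h in at 0. 0 \<le> \<bar>(max 0 h)\<^sup>2 / (h::real)\<bar>" by simp
      show "\<forall>\<^sub>F h in at 0. \<bar>(max 0 h)\<^sup>2 / (h::real)\<bar> \<le> \<bar>h\<bar>"
        by (intro always_eventually allI) (auto simp: max_def power2_eq_square)
      show "((\<lambda>h::real. \<bar>h\<bar>) \<longlongrightarrow> 0) (at 0)" by (intro tendsto_eq_intros) auto
    qed auto
    then show ?thesis unfolding 2 by (simp add: has_field_derivative_iff)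
  next
    case 3
    have "((\<lambda>t. t\<^sup>2) has_field_derivative 2 * max 0 t) (at t)"
      using 3 by (auto intro!: derivative_eq_intros)
    then show ?thesis
      by (rule has_field_derivative_transform_within_open[of _ _ _ "{0<..}"]) (use 3 in auto)
  qed
qed

text \<open>There are \<open>8 ^ k\<close> holes of side \<open>a = 1 / 3 ^ Suc k\<close>, and in each of them
the points at distance \<open>t\<close> from the sides form a square of perimeter \<open>4 * (a -
2 * t)\<close>.\<close>

definition hole_density :: "nat \<Rightarrow> real \<Rightarrow> real" where
  "hole_density k t = 4 * 8 ^ k * max 0 (1 / 3 ^ Suc k - 2 * t)"

text \<open>The derivative in \<open>t\<close> of the area of the \<open>t\<close>-neighbourhood, cut off at
\<open>\<delta>\<close>; the part \<open>4 + 2 * pi * t\<close> is the length of the outer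
parallel curve of the square.\<close>

definition carpet_density :: "real \<Rightarrow> real \<Rightarrow> real" where
  "carpet_density \<delta> t = indicator {0<..<\<delta>} t * (4 + 2 * pi * t + (\<Sum>k. hole_density k t))"

lemma hole_density_nonneg: "0 \<le> hole_density k t"
  by (simp add: hole_density_def)

lemma hole_density_measurable [measurable]: "hole_density k \<in> borel_measurable borel"
  unfolding hole_density_def by measurable

text \<open>Only the finitely many holes wide enough to contain points at distance \<open>t\<close>
contribute.\<close>

lemma summable_hole_density:
  assumes t: "0 < t"
  shows "summable (\<lambda>k. hole_density k t)"
proof -
  obtain n where n: "1 / t < 3 ^ n" using real_arch_pow[of 3 "1/t"] by auto
  have "hole_density k t = 0" if "k \<ge> n" for k
  proof -
    have "1 / t < 3 ^ Suc k" using n that by (meson lessI less_imp_le less_le_trans one_le_numeral le_SucI power_increasing)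
    then have "1 / 3 ^ Suc k < t" using t by (simp add: field_simps)
    then show ?thesis using t by (simp add: hole_density_def)
  qed
  then show ?thesis by (intro summable_finite[of "{..<n}"]) (auto simp: not_less)
qed

lemma carpet_density_measurable [measurable]: "carpet_density \<delta> \<in> borel_measurable borel"
  unfolding carpet_density_def by measurable

lemma carpet_density_nonneg: "0 \<le> carpet_density \<delta> t"
proof (cases "0 < t")
  case True
  then show ?thesis unfolding carpet_density_def
    by (intro mult_nonneg_nonneg add_nonneg_nonneg suminf_nonneg summable_hole_density)
      (auto simp: hole_density_nonneg)
qed (simp add: carpet_density_def)

lemma nn_integral_open_interval:
  "(\<integral>\<^sup>+x. f x * indicator {a<..<b::real} x \<partial>lborel) = (\<integral>\<^sup>+x. f x * indicator {a..b} x \<partial>lborel)"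
proof (rule nn_integral_cong_AE)
  have "AE x in lborel. x \<noteq> a" "AE x in lborel. x \<noteq> b" by (auto intro: AE_lborel_singleton)
  then show "AE x in lborel. f x * indicator {a<..<b} x = f x * indicator {a..b} x"
    by eventually_elim (auto split: split_indicator)
qed

lemma nn_integral_hole_density:
  assumes r: "0 < r"
  shows "(\<integral>\<^sup>+x. ennreal (hole_density k x) * indicator {0<..<r} x \<partial>lborel) =
    ennreal (8 ^ k * ((1 / 3 ^ Suc k)\<^sup>2 - (max 0 (1 / 3 ^ Suc k - 2 * r))\<^sup>2))"
proof -
  let ?F = "\<lambda>t. - (8 ^ k * (max 0 (1 / 3 ^ Suc k - 2 * t))\<^sup>2) :: real"
  have "(?F has_real_derivative hole_density k t) (at t)" for t
  proof -
    have "((\<lambda>t. (max 0 (1 / 3 ^ Suc k - 2 * t))\<^sup>2) has_real_derivative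
        2 * max 0 (1 / 3 ^ Suc k - 2 * t) * (- 2)) (at t)"
      by (rule DERIV_chain2[OF has_field_derivative_max_sq]) (auto intro!: derivative_eq_intros)
    from DERIV_minus[OF DERIV_cmult[OF this, of "8 ^ k"]] show ?thesis
      by (simp add: hole_density_def algebra_simps)
  qed
  then have "(\<integral>\<^sup>+x. ennreal (hole_density k x) * indicator {0..r} x \<partial>lborel) = ?F r - ?F 0"
    using r by (intro nn_integral_FTC_Icc) (auto simp: hole_density_nonneg)
  also have "?F r - ?F 0 = 8 ^ k * ((1 / 3 ^ Suc k)\<^sup>2 - (max 0 (1 / 3 ^ Suc k - 2 * r))\<^sup>2)"
    by (simp add: algebra_simps)
  finally show ?thesis by (simp add: nn_integral_open_interval)
qed

text \<open>The holes have total area 1, so the carpet is a null set.\<close>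

lemma holes_exhaust_square: "(\<lambda>k. 8 ^ k * (1 / 3 ^ Suc k)\<^sup>2) sums (1::real)"
proof -
  have "(\<lambda>k. 1/9 * (8/9) ^ k) sums (1/9 * (1 / (1 - 8/9 :: real)))"
    by (intro sums_mult geometric_sums) auto
  moreover have "(1/3 ^ Suc k)\<^sup>2 = 1/9 * (1/9::real) ^ k" for k
    by (simp add: power_mult_distrib power_divide flip: power_mult) (simp add: power_mult mult.commute[of k 2])
  ultimately show ?thesis by (simp add: power_divide)
qed

text \<open>Term by term integration: each hole yields its area minus the area of its points at distance at
least \<open>r\<close>, and these add up to the area formula because the holes exhaust the square.\<close>

lemma nn_integral_carpet_density:
  assumes r: "0 < r"
  shows "(\<integral>\<^sup>+x. ennreal (carpet_density r x) \<partial>lborel) = emeasure lebesgue (nbhd sierpinski_carpet r)"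
proof -
  let ?V = "measure lebesgue (nbhd sierpinski_carpet r)"
  let ?c = "\<lambda>k. 8 ^ k * ((1 / 3 ^ Suc k)\<^sup>2 - (max 0 (1 / 3 ^ Suc k - 2 * r))\<^sup>2)"
  have "(\<lambda>k. 8 ^ k * (1 / 3 ^ Suc k)\<^sup>2 - 8 ^ k * (max 0 (1 / 3 ^ Suc k - 2 * r))\<^sup>2) sums
      (1 - (1 + 4 * r + pi * r\<^sup>2 - ?V))"
    by (intro sums_diff holes_exhaust_square carpet_nbhd_measure(2) r)
  then have c: "?c sums (?V - 4 * r - pi * r\<^sup>2)" by (simp add: algebra_simps)
  have c0: "0 \<le> ?c k" for k
    using r by (intro mult_nonneg_nonneg) (auto simp: max_def power_mono)
  have outer: "(\<integral>\<^sup>+x. ennreal (4 + 2 * pi * x) * indicator {0<..<r} x \<partial>lborel) = ennreal (4 * r + pi * r\<^sup>2)"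
  proof -
    have "(\<integral>\<^sup>+x. ennreal (4 + 2 * pi * x) * indicator {0..r} x \<partial>lborel) =
        (4 * r + pi * r\<^sup>2) - (4 * 0 + pi * 0\<^sup>2)"
      using r by (intro nn_integral_FTC_Icc) (auto intro!: derivative_eq_intros)
    then show ?thesis by (simp add: nn_integral_open_interval)
  qed
  have "ennreal (carpet_density r x) = ennreal (4 + 2 * pi * x) * indicator {0<..<r} x
      + (\<Sum>k. ennreal (hole_density k x) * indicator {0<..<r} x)" for x
  proof (cases "x \<in> {0<..<r}")
    case True
    then have "0 \<le> (\<Sum>k. hole_density k x)"
      by (intro suminf_nonneg summable_hole_density) (auto simp: hole_density_nonneg)
    then show ?thesis
      using True by (simp add: carpet_density_def suminf_ennreal2 hole_density_nonneg summable_hole_density)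
  qed (simp add: carpet_density_def)
  then have "(\<integral>\<^sup>+x. ennreal (carpet_density r x) \<partial>lborel) =
      (\<integral>\<^sup>+x. ennreal (4 + 2 * pi * x) * indicator {0<..<r} x \<partial>lborel) +
      (\<integral>\<^sup>+x. (\<Sum>k. ennreal (hole_density k x) * indicator {0<..<r} x) \<partial>lborel)"
    by (simp add: nn_integral_add)
  also have "(\<integral>\<^sup>+x. (\<Sum>k. ennreal (hole_density k x) * indicator {0<..<r} x) \<partial>lborel) =
      (\<Sum>k. \<integral>\<^sup>+x. ennreal (hole_density k x) * indicator {0<..<r} x \<partial>lborel)"
    by (intro nn_integral_suminf) auto
  also have "\<dots> = (\<Sum>k. ennreal (?c k))"
    by (simp only: nn_integral_hole_density[OF r])
  also have "\<dots> = ennreal (?V - 4 * r - pi * r\<^sup>2)"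
    using c c0 by (simp only: suminf_ennreal2 sums_unique[symmetric] sums_summable)
  also note outer
  also have "ennreal (4 * r + pi * r\<^sup>2) + ennreal (?V - 4 * r - pi * r\<^sup>2) = ennreal ?V"
    using r sums_le[OF c0 sums_zero c] by (subst ennreal_plus[symmetric]) auto
  also have "ennreal ?V = emeasure lebesgue (nbhd sierpinski_carpet r)"
    using carpet_nbhd_measure(1)[OF r] by (intro emeasure_eq_measure2[symmetric]) (auto simp: fmeasurable_def)
  finally show ?thesis .
qed

text \<open>Both sides are finite measures on the line that agree on all half-lines \<open>{..<r}\<close>,
where the left one is the area of a neighbourhood and the right one is its integral formula.\<close>

lemma carpet_dist_distribution:
  assumes \<delta>: "0 < \<delta>"
  shows "distr (restrict_space lebesgue (nbhd sierpinski_carpet \<delta>)) borel (\<lambda>x. infdist x sierpinski_carpet) =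
    density lborel (\<lambda>t. ennreal (carpet_density \<delta> t))" (is "?M = ?N")
proof (rule measure_eqI_generator_eq[where E = "range lessThan" and \<Omega> = UNIV and A = "\<lambda>n. {..<real n}"])
  let ?A = sierpinski_carpet
  have [measurable]: "(\<lambda>x. infdist x ?A) \<in> borel_measurable lebesgue"
  proof -
    have "(\<lambda>x. infdist x ?A) \<in> borel_measurable borel"
      by (intro borel_measurable_continuous_onI continuous_on_infdist continuous_on_id)
    then show ?thesis by (intro measurable_completion) simp
  qed
  have N: "nbhd ?A \<delta> \<in> sets lebesgue" using carpet_nbhd_measure(1)[OF \<delta>] by auto
  have L: "emeasure ?M {..<r} = emeasure lebesgue (nbhd ?A (min r \<delta>))" for r
  proof -
    have "emeasure ?M {..<r} = emeasure (restrict_space lebesgue (nbhd ?A \<delta>))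
        ((\<lambda>x. infdist x ?A) -` {..<r} \<inter> nbhd ?A \<delta>)"
      using N by (subst emeasure_distr) (auto intro: measurable_restrict_space1 simp: space_restrict_space)
    also have "(\<lambda>x. infdist x ?A) -` {..<r} \<inter> nbhd ?A \<delta> = nbhd ?A (min r \<delta>)"
      by (auto simp: nbhd_def)
    also have "emeasure (restrict_space lebesgue (nbhd ?A \<delta>)) (nbhd ?A (min r \<delta>)) = emeasure lebesgue (nbhd ?A (min r \<delta>))"
      using N by (intro emeasure_restrict_space) (auto simp: nbhd_def)
    finally show ?thesis .
  qed
  have eq: "emeasure ?M {..<r} = emeasure ?N {..<r}" for r
  proof (cases "0 < r")
    case True
    then have "ennreal (carpet_density \<delta> x) * indicator {..<r} x = ennreal (carpet_density (min r \<delta>) x)" for x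
      by (auto simp: carpet_density_def split: split_indicator)
    then have "emeasure ?N {..<r} = (\<integral>\<^sup>+x. ennreal (carpet_density (min r \<delta>) x) \<partial>lborel)"
      by (subst emeasure_density) auto
    then show ?thesis using True \<delta> by (simp add: L nn_integral_carpet_density)
  next
    case False
    have "\<not> infdist x ?A < min r \<delta>" for x
      using False infdist_nonneg[of x ?A] by (auto simp: min_def)
    then have "nbhd ?A (min r \<delta>) = {}" by (simp add: nbhd_def)
    moreover have "emeasure ?N {..<r} = 0"
    proof -
      have zero: "ennreal (carpet_density \<delta> x) * indicator {..<r} x = 0" for x
        using False by (auto simp: carpet_density_def split: split_indicator)
      have "emeasure ?N {..<r} = (\<integral>\<^sup>+x. ennreal (carpet_density \<delta> x) * indicator {..<r} x \<partial>lborel)"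
        by (subst emeasure_density) auto
      then show ?thesis unfolding zero by simp
    qed
    ultimately show ?thesis by (simp add: L)
  qed
  show "Int_stable (range (lessThan :: real \<Rightarrow> _))"
  proof -
    have "{..<a} \<inter> {..<b} = {..<min a b}" for a b :: real by auto
    then show ?thesis by (auto simp: Int_stable_def)
  qed
  show "emeasure ?M X = emeasure ?N X" if "X \<in> range lessThan" for X
    using that eq by auto
  show "sets ?M = sigma_sets UNIV (range lessThan)" "sets ?N = sigma_sets UNIV (range lessThan)"
    by (simp_all add: borel_Iio)
  show "(\<Union>n. {..<real n}) = UNIV" by (auto intro: reals_Archimedean2)
  show "emeasure ?M {..<real n} \<noteq> \<infinity>" for n
  proof -
    have "emeasure ?M {..<real n} \<le> emeasure lebesgue (nbhd ?A \<delta>)"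
      unfolding L using N by (intro emeasure_mono) (auto simp: nbhd_def)
    also have "\<dots> < \<infinity>" using carpet_nbhd_measure(1)[OF \<delta>] by (auto simp: fmeasurable_def)
    finally show ?thesis by simp
  qed
qed auto

section \<open>The zeta function on its half-plane of convergence\<close>

lemma borel_measurable_of_real_powr [measurable]:
  "(\<lambda>t::real. complex_of_real t powr c) \<in> borel_measurable borel"
  unfolding powr_def by measurable

lemma norm_of_real_powr: "norm (complex_of_real t powr c) = t powr Re c" if "0 \<le> t"
  using that by (cases "t = 0") (auto simp: norm_powr_real_powr)

text \<open>The antiderivative \<open>t powr z / z\<close> extends continuously to 0 because \<open>Re z >
0\<close>, although the integrand may be unbounded there; absolute integrability comes from the
real power \<open>Re z - 1\<close>.\<close>

lemma has_bochner_integral_powr: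
  assumes z: "0 < Re z" and b: "0 < b"
  shows "has_bochner_integral lborel (\<lambda>t. indicator {0<..<b} t *\<^sub>R (complex_of_real t powr (z - 1))) (of_real b powr z / z)"
proof -
  let ?f = "\<lambda>t. complex_of_real t powr (z - 1)"
  have HI: "(?f has_integral (of_real b powr z / z - of_real 0 powr z / z)) {0..b}"
    using z b
    by (intro fundamental_theorem_of_calculus_interior)
      (auto intro!: continuous_intros derivative_eq_intros has_vector_derivative_real_field)
  have "(\<lambda>t. norm (?f t)) integrable_on {0..b}"
  proof (rule integrable_eq)
    show "(\<lambda>t. t powr (Re z - 1)) integrable_on {0..b}"
      using z b by (intro integrable_on_powr_from_0) auto
  qed (auto simp: norm_of_real_powr)
  then have abs: "set_integrable lebesgue {0..b} ?f"
    using HI by (intro absolutely_integrable_onI) auto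
  have ae: "AE t in lborel. indicator {0..b} t *\<^sub>R ?f t = indicator {0<..<b} t *\<^sub>R ?f t"
  proof -
    have "AE x in lborel. x \<noteq> 0" "AE x in lborel. x \<noteq> b" by (auto intro: AE_lborel_singleton)
    then show ?thesis by eventually_elim (auto split: split_indicator)
  qed
  have meas [measurable]: "(\<lambda>t. indicator {0..b} t *\<^sub>R ?f t) \<in> borel_measurable lborel" by measurable
  have "has_bochner_integral lborel (\<lambda>t. indicator {0..b} t *\<^sub>R ?f t) (of_real b powr z / z)"
    using set_lebesgue_integral_eq_integral(2)[OF abs] abs integral_unique[OF HI] z
      integrable_completion[OF meas] integral_completion[OF meas]
    by (simp add: has_bochner_integral_iff set_integrable_def set_lebesgue_integral_def)
  then show ?thesis
    using ae by (subst (asm) has_bochner_integral_cong_AE) auto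
qed

abbreviation carpet_dim :: real where "carpet_dim \<equiv> log 3 8"

lemma carpet_dim_bounds: "1 < carpet_dim" "carpet_dim < 2"
  by (auto simp: less_log_iff log_less_iff)

text \<open>The integrand of the zeta function depends on \<open>x\<close> only through the distance, so the
change of variables to the distance reduces convergence and value to integrals over the line.\<close>

lemma carpet_integral_transfer:
  assumes \<delta>: "0 < \<delta>"
  shows "set_integrable lebesgue (nbhd sierpinski_carpet \<delta>) (dist_power sierpinski_carpet s) \<longleftrightarrow>
      integrable lborel (\<lambda>t. carpet_density \<delta> t *\<^sub>R (complex_of_real t powr (s - 2)))"
    and "distance_zeta sierpinski_carpet \<delta> s =
      (\<integral>t. carpet_density \<delta> t *\<^sub>R (complex_of_real t powr (s - 2)) \<partial>lborel)"
proof -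
  let ?A = sierpinski_carpet and ?h = "\<lambda>t. complex_of_real t powr (s - 2)"
  let ?R = "restrict_space lebesgue (nbhd ?A \<delta>)"
  have dp: "dist_power ?A s = (\<lambda>x. ?h (infdist x ?A))"
    by (simp add: dist_power_def fun_eq_iff)
  have N: "nbhd ?A \<delta> \<inter> space lebesgue \<in> sets lebesgue" using carpet_nbhd_measure(1)[OF \<delta>] by auto
  have "(\<lambda>x. infdist x ?A) \<in> borel_measurable borel"
    by (intro borel_measurable_continuous_onI continuous_on_infdist continuous_on_id)
  then have "(\<lambda>x. infdist x ?A) \<in> borel_measurable lebesgue"
    by (intro measurable_completion) simp
  then have m: "(\<lambda>x. infdist x ?A) \<in> measurable ?R borel" by (rule measurable_restrict_space1)
  have "set_integrable lebesgue (nbhd ?A \<delta>) (dist_power ?A s) \<longleftrightarrow> integrable ?R (\<lambda>x. ?h (infdist x ?A))"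
    unfolding set_integrable_def dp by (rule integrable_restrict_space[OF N, symmetric])
  also have "\<dots> \<longleftrightarrow> integrable (density lborel (\<lambda>t. ennreal (carpet_density \<delta> t))) ?h"
    unfolding carpet_dist_distribution[OF \<delta>, symmetric]
    by (rule integrable_distr_eq[OF m, symmetric]) simp
  also have "\<dots> \<longleftrightarrow> integrable lborel (\<lambda>t. carpet_density \<delta> t *\<^sub>R ?h t)"
    by (rule integrable_density) (auto simp: carpet_density_nonneg)
  finally show "set_integrable lebesgue (nbhd ?A \<delta>) (dist_power ?A s) \<longleftrightarrow> \<dots>" .
  have "distance_zeta ?A \<delta> s = (\<integral>x. ?h (infdist x ?A) \<partial>?R)"
    unfolding distance_zeta_def set_lebesgue_integral_def dp
    by (rule integral_restrict_space[OF N, symmetric])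
  also have "\<dots> = (\<integral>t. ?h t \<partial>density lborel (\<lambda>t. ennreal (carpet_density \<delta> t)))"
    unfolding carpet_dist_distribution[OF \<delta>, symmetric]
    by (rule integral_distr[OF m, symmetric]) simp
  also have "\<dots> = (\<integral>t. carpet_density \<delta> t *\<^sub>R ?h t \<partial>lborel)"
    by (rule integral_density) (auto simp: carpet_density_nonneg)
  finally show "distance_zeta ?A \<delta> s = \<dots>" .
qed

text \<open>With \<open>b = a / 2\<close> for holes of side \<open>a\<close> this is the integral of \<open>8
^ Suc k * (b - t) * t powr (s - 2)\<close> over \<open>{0<..<b}\<close>.\<close>

lemma has_bochner_integral_hole:
  assumes s: "1 < Re s"
  shows "has_bochner_integral lborel (\<lambda>t. (indicator {0<..} t * hole_density k t) *\<^sub>R (complex_of_real t powr (s - 2)))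
    (8 ^ Suc k * of_real (1 / (2 * 3 ^ Suc k)) powr s / (s * (s - 1)))"
proof -
  define b :: real where "b = 1 / (2 * 3 ^ Suc k)"
  have b: "0 < b" by (simp add: b_def)
  have s0: "s \<noteq> 0" "s - 1 \<noteq> 0" using s by auto
  have "has_bochner_integral lborel
     (\<lambda>t. 8 ^ Suc k * of_real b * (indicator {0<..<b} t *\<^sub>R (complex_of_real t powr (s - 1 - 1))) -
          8 ^ Suc k * (indicator {0<..<b} t *\<^sub>R (complex_of_real t powr (s - 1))))
     (8 ^ Suc k * of_real b * (of_real b powr (s - 1) / (s - 1)) - 8 ^ Suc k * (of_real b powr s / s))"
    using s b
    by (intro has_bochner_integral_diff has_bochner_integral_mult_right has_bochner_integral_powr) auto
  also have "8 ^ Suc k * of_real b * (of_real b powr (s - 1) / (s - 1)) - 8 ^ Suc k * (of_real b powr s / s)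
      = 8 ^ Suc k * of_real b powr s / (s * (s - 1))"
  proof -
    have "of_real b powr (s - 1) = of_real b powr s / of_real b"
      using b by (simp add: powr_diff)
    then show ?thesis using b s0 by (simp add: field_simps)
  qed
  also have "(\<lambda>t. 8 ^ Suc k * of_real b * (indicator {0<..<b} t *\<^sub>R (complex_of_real t powr (s - 1 - 1))) -
          8 ^ Suc k * (indicator {0<..<b} t *\<^sub>R (complex_of_real t powr (s - 1)))) =
      (\<lambda>t. (indicator {0<..} t * hole_density k t) *\<^sub>R (complex_of_real t powr (s - 2)))"
  proof
    fix t
    have hd: "hole_density k t = (if t < b then 8 ^ Suc k * (b - t) else 0)"
      by (auto simp: hole_density_def b_def max_def field_simps)
    show "8 ^ Suc k * of_real b * (indicator {0<..<b} t *\<^sub>R (complex_of_real t powr (s - 1 - 1))) -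
          8 ^ Suc k * (indicator {0<..<b} t *\<^sub>R (complex_of_real t powr (s - 1))) =
       (indicator {0<..} t * hole_density k t) *\<^sub>R (complex_of_real t powr (s - 2))"
    proof (cases "0 < t \<and> t < b")
      case True
      have "complex_of_real t powr (s - 1) = of_real t * complex_of_real t powr (s - 2)"
        using True powr_add[of "complex_of_real t" 1 "s - 2"] by simp
      then show ?thesis using True by (simp add: hd scaleR_conv_of_real algebra_simps)
    qed (auto simp: hd)
  qed
  finally show ?thesis by (simp add: b_def)
qed

lemma summable_truncated_hole_density: "summable (\<lambda>k. indicator {0<..} t * hole_density k t)"
  by (cases "0 < t") (auto simp: summable_hole_density)

text \<open>The bound \<open>\<delta> > 1/6\<close> says that the neighbourhood contains even the largest
hole, of side 1/3, so that the hole densities are not affected by the cut-off at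
\<open>\<delta>\<close>.\<close>

lemma carpet_density_split:
  assumes \<delta>: "1 / 6 < \<delta>"
  shows "carpet_density \<delta> t *\<^sub>R (w::complex) =
    indicator {0<..<\<delta>} t *\<^sub>R ((4 + 2 * pi * t) *\<^sub>R w) + (\<Sum>k. (indicator {0<..} t * hole_density k t) *\<^sub>R w)"
proof -
  let ?I = "indicator {0<..<\<delta>} t :: real"
  have cut: "indicator {0<..} t * hole_density k t = ?I * hole_density k t" for k
  proof (cases "t < \<delta>")
    case False
    have "1 / 3 ^ Suc k \<le> (1 / 3 :: real)" by (simp add: field_simps)
    then have "1 / 3 ^ Suc k - 2 * t \<le> 0" using False \<delta> by linarith
    then show ?thesis by (simp add: hole_density_def)
  qed (auto split: split_indicator)
  have "(\<Sum>k. (indicator {0<..} t * hole_density k t) *\<^sub>R w) = (\<Sum>k. indicator {0<..} t * hole_density k t) *\<^sub>R w"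
    by (rule suminf_scaleR_left[OF summable_truncated_hole_density, symmetric])
  also have "\<dots> = (?I * (\<Sum>k. hole_density k t)) *\<^sub>R w"
    unfolding cut by (cases "t \<in> {0<..<\<delta>}") auto
  finally show ?thesis
    by (simp add: carpet_density_def scaleR_add_left[symmetric] ring_distribs)
qed

lemma has_bochner_integral_outer:
  assumes s: "1 < Re s" and \<delta>: "0 < \<delta>"
  shows "has_bochner_integral lborel (\<lambda>t. indicator {0<..<\<delta>} t *\<^sub>R ((4 + 2 * pi * t) *\<^sub>R (complex_of_real t powr (s - 2))))
    (4 * (of_real \<delta> powr (s - 1) / (s - 1)) + 2 * of_real pi * (of_real \<delta> powr s / s))"
proof -
  have "has_bochner_integral lborel
     (\<lambda>t. 4 * (indicator {0<..<\<delta>} t *\<^sub>R (complex_of_real t powr (s - 1 - 1))) +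
          2 * of_real pi * (indicator {0<..<\<delta>} t *\<^sub>R (complex_of_real t powr (s - 1))))
    (4 * (of_real \<delta> powr (s - 1) / (s - 1)) + 2 * of_real pi * (of_real \<delta> powr s / s))"
    using s \<delta>
    by (intro has_bochner_integral_add has_bochner_integral_mult_right has_bochner_integral_powr) auto
  also have "(\<lambda>t. 4 * (indicator {0<..<\<delta>} t *\<^sub>R (complex_of_real t powr (s - 1 - 1))) +
          2 * of_real pi * (indicator {0<..<\<delta>} t *\<^sub>R (complex_of_real t powr (s - 1)))) =
      (\<lambda>t. indicator {0<..<\<delta>} t *\<^sub>R ((4 + 2 * pi * t) *\<^sub>R (complex_of_real t powr (s - 2))))"
  proof
    fix t
    show "4 * (indicator {0<..<\<delta>} t *\<^sub>R (complex_of_real t powr (s - 1 - 1))) +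
          2 * of_real pi * (indicator {0<..<\<delta>} t *\<^sub>R (complex_of_real t powr (s - 1))) =
        indicator {0<..<\<delta>} t *\<^sub>R ((4 + 2 * pi * t) *\<^sub>R (complex_of_real t powr (s - 2)))"
    proof (cases "0 < t \<and> t < \<delta>")
      case True
      have "complex_of_real t powr (s - 1) = of_real t * complex_of_real t powr (s - 2)"
        using True powr_add[of "complex_of_real t" 1 "s - 2"] by simp
      then show ?thesis using True by (simp add: scaleR_conv_of_real algebra_simps)
    qed auto
  qed
  finally show ?thesis .
qed

definition carpet_zeta_formula :: "real \<Rightarrow> complex \<Rightarrow> complex" where
  "carpet_zeta_formula \<delta> s = 8 / (2 powr s * s * (s - 1) * (3 powr s - 8))
         + 2 * of_real pi * (of_real \<delta> powr s / s)
         + 4 * (of_real \<delta> powr (s - 1) / (s - 1))"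

lemma of_real_powr_exp: "0 < x \<Longrightarrow> complex_of_real x powr s = exp (s * of_real (ln x))"
  by (simp add: powr_def Ln_of_real)

lemma numeral_powr_exp: "(2::complex) powr s = exp (s * of_real (ln 2))" "(3::complex) powr s = exp (s * of_real (ln 3))"
  using of_real_powr_exp[of 2 s] of_real_powr_exp[of 3 s] by simp_all

lemma hole_term_geometric:
  "8 ^ Suc k * complex_of_real (1 / (2 * 3 ^ Suc k)) powr s = (8 / (2 powr s * 3 powr s)) * (8 / 3 powr s) ^ k"
proof -
  have "ln (2 * 3 ^ Suc k :: real) = ln 2 + real (Suc k) * ln 3"
    by (subst ln_mult) (simp_all only: ln_realpow, simp_all)
  then have ln: "ln (1 / (2 * 3 ^ Suc k) :: real) = - ln 2 - real (Suc k) * ln 3"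
    by (subst ln_div) simp_all
  have pos: "0 < 1 / (2 * 3 ^ Suc k :: real)" by simp
  have "complex_of_real (1 / (2 * 3 ^ Suc k)) powr s = exp (- (s * of_real (ln 2)) - of_nat (Suc k) * (s * of_real (ln 3)))"
    unfolding of_real_powr_exp[OF pos] ln
    by (simp add: algebra_simps)
  also have "\<dots> = 1 / (2 powr s * (3 powr s) ^ Suc k)"
    unfolding exp_diff exp_of_nat_mult exp_minus numeral_powr_exp by (simp add: field_simps)
  finally show ?thesis by (simp add: power_divide)
qed

lemma norm_hole_ratio: "norm (8 / 3 powr s :: complex) = 8 / 3 powr (Re s)"
  using norm_of_real_powr[of 3 s] by (simp add: norm_divide)

lemma hole_ratio_less_1: "carpet_dim < Re s \<Longrightarrow> norm (8 / 3 powr s :: complex) < 1"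
  using powr_less_mono[of carpet_dim "Re s" 3] by (simp add: norm_hole_ratio)

lemma hole_terms_sums:
  assumes s: "carpet_dim < Re s"
  shows "(\<lambda>k. 8 ^ Suc k * of_real (1 / (2 * 3 ^ Suc k)) powr s / (s * (s - 1))) sums
    (8 / (2 powr s * s * (s - 1) * (3 powr s - 8)))"
proof -
  define a b c where abc: "a = (3::complex) powr s" "b = (2::complex) powr s" "c = s * (s - 1)"
  have "(\<lambda>k. 8 / (b * a) * (8 / a) ^ k / c) sums (8 / (b * a) * (1 / (1 - 8 / a)) / c)"
    unfolding abc using hole_ratio_less_1[OF s] by (intro sums_divide sums_mult geometric_sums)
  also have "8 / (b * a) * (1 / (1 - 8 / a)) / c = 8 / (b * c * (a - 8))"
  proof -
    have "a \<noteq> 0" "a \<noteq> 8" using hole_ratio_less_1[OF s] by (auto simp: abc norm_divide)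
    moreover have "b \<noteq> 0" "c \<noteq> 0" using s carpet_dim_bounds(1) by (auto simp: abc)
    ultimately show ?thesis by (simp add: field_simps)
  qed
  finally show ?thesis
    unfolding hole_term_geometric abc by (simp only: mult.assoc)
qed

text \<open>Integration and summation over the generations may be exchanged because the integrals of the
absolute values are the terms of the same series at the real point \<open>Re s\<close>.\<close>

lemma carpet_zeta_integral:
  assumes \<delta>: "1 / 6 < \<delta>" and s: "carpet_dim < Re s"
  shows "set_integrable lebesgue (nbhd sierpinski_carpet \<delta>) (dist_power sierpinski_carpet s)"
    and "distance_zeta sierpinski_carpet \<delta> s = carpet_zeta_formula \<delta> s"
proof -
  have \<delta>0: "0 < \<delta>" using \<delta> by simp
  have s1: "1 < Re s" using s carpet_dim_bounds(1) by linarith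
  define h where "h = (\<lambda>t. complex_of_real t powr (s - 2))"
  define f where "f = (\<lambda>k t. (indicator {0<..} t * hole_density k t) *\<^sub>R h t)"
  define g where "g = (\<lambda>t. indicator {0<..<\<delta>} t *\<^sub>R ((4 + 2 * pi * t) *\<^sub>R h t))"
  have f: "has_bochner_integral lborel (f k) (8 ^ Suc k * of_real (1 / (2 * 3 ^ Suc k)) powr s / (s * (s - 1)))" for k
    unfolding f_def h_def by (rule has_bochner_integral_hole[OF s1])
  have split: "carpet_density \<delta> t *\<^sub>R h t = g t + (\<Sum>k. f k t)" for t
    unfolding f_def g_def by (rule carpet_density_split[OF \<delta>])
  have fi: "integrable lborel (f k)" for k using f by (auto simp: has_bochner_integral_iff)
  have pw: "AE t in lborel. summable (\<lambda>k. norm (f k t))"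
  proof (intro AE_I2)
    fix t
    have "summable (\<lambda>k. indicator {0<..} t * hole_density k t * norm (h t))"
      by (intro summable_mult2 summable_truncated_hole_density)
    then show "summable (\<lambda>k. norm (f k t))"
      by (simp add: f_def hole_density_nonneg)
  qed
  \<comment> \<open>The norm of the integrand is the integrand at the real point \<open>Re s\<close>.\<close>
  have nrm: "(\<integral>t. norm (f k t) \<partial>lborel) = Re (8 ^ Suc k * of_real (1 / (2 * 3 ^ Suc k)) powr of_real (Re s) / (of_real (Re s) * (of_real (Re s) - 1)))" for k
  proof -
    have "norm (f k t) = Re ((indicator {0<..} t * hole_density k t) *\<^sub>R (complex_of_real t powr (of_real (Re s) - 2)))" for t
    proof (cases "0 < t")
      case True
      have "complex_of_real t powr (of_real (Re s) - 2) = of_real (t powr (Re s - 2))"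
        using True powr_of_real[of t "Re s - 2"] by simp
      then show ?thesis using True by (simp add: f_def h_def norm_of_real_powr hole_density_nonneg)
    qed (simp add: f_def)
    then have "(\<integral>t. norm (f k t) \<partial>lborel) =
       (\<integral>t. Re ((indicator {0<..} t * hole_density k t) *\<^sub>R (complex_of_real t powr (of_real (Re s) - 2))) \<partial>lborel)"
      by simp
    also have "\<dots> = Re (\<integral>t. (indicator {0<..} t * hole_density k t) *\<^sub>R (complex_of_real t powr (of_real (Re s) - 2)) \<partial>lborel)"
      using has_bochner_integral_hole[of "of_real (Re s)" k] s1 by (intro integral_Re) (auto simp: has_bochner_integral_iff)
    finally show ?thesis
      using has_bochner_integral_hole[of "of_real (Re s)" k] s1 by (simp only: has_bochner_integral_iff Re_complex_of_real)
  qed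
  have sm: "summable (\<lambda>k. \<integral>t. norm (f k t) \<partial>lborel)"
    unfolding nrm using hole_terms_sums[of "of_real (Re s)"] s by (intro summable_Re sums_summable) auto
  have g: "has_bochner_integral lborel g (4 * (of_real \<delta> powr (s - 1) / (s - 1)) + 2 * of_real pi * (of_real \<delta> powr s / s))"
    unfolding g_def h_def by (rule has_bochner_integral_outer[OF s1 \<delta>0])
  have gi: "integrable lborel g" using g by (auto simp: has_bochner_integral_iff)
  have Si: "integrable lborel (\<lambda>t. \<Sum>k. f k t)" by (rule integrable_suminf[OF fi pw sm])
  show "set_integrable lebesgue (nbhd sierpinski_carpet \<delta>) (dist_power sierpinski_carpet s)"
    unfolding carpet_integral_transfer(1)[OF \<delta>0] h_def[symmetric, THEN fun_cong] split
    by (intro Bochner_Integration.integrable_add gi Si)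
  have "distance_zeta sierpinski_carpet \<delta> s = (\<integral>t. g t + (\<Sum>k. f k t) \<partial>lborel)"
    unfolding carpet_integral_transfer(2)[OF \<delta>0] split[symmetric] h_def ..
  also have "\<dots> = (\<integral>t. g t \<partial>lborel) + (\<integral>t. (\<Sum>k. f k t) \<partial>lborel)"
    by (intro Bochner_Integration.integral_add gi Si)
  also have "(\<integral>t. (\<Sum>k. f k t) \<partial>lborel) = 8 / (2 powr s * s * (s - 1) * (3 powr s - 8))"
    using sums_integral[OF fi pw sm] hole_terms_sums[OF s]
    unfolding has_bochner_integral_integral_eq[OF f] by (rule sums_unique2)
  also have "(\<integral>t. g t \<partial>lborel) = 4 * (of_real \<delta> powr (s - 1) / (s - 1)) + 2 * of_real pi * (of_real \<delta> powr s / s)"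
    using g by (simp add: has_bochner_integral_iff)
  finally show "distance_zeta sierpinski_carpet \<delta> s = carpet_zeta_formula \<delta> s"
    by (simp add: carpet_zeta_formula_def)
qed

text \<open>At \<open>s = log 3 8\<close> every generation of holes contributes the same positive amount, so
the partial sums of the integral are unbounded.\<close>

lemma carpet_zeta_divergent:
  assumes \<delta>: "1 / 6 < \<delta>"
  shows "\<not> set_integrable lebesgue (nbhd sierpinski_carpet \<delta>) (dist_power sierpinski_carpet (of_real carpet_dim))"
proof
  let ?D = "complex_of_real carpet_dim"
  assume "set_integrable lebesgue (nbhd sierpinski_carpet \<delta>) (dist_power sierpinski_carpet ?D)"
  moreover have \<delta>0: "0 < \<delta>" using \<delta> by simp
  ultimately have int: "integrable lborel (\<lambda>t. carpet_density \<delta> t *\<^sub>R (complex_of_real t powr (?D - 2)))"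
    by (simp only: carpet_integral_transfer(1))
  define h where "h = (\<lambda>t::real. t powr (carpet_dim - 2))"
  have hc: "complex_of_real t powr (?D - 2) = of_real (h t)" if "0 < t" for t
    using that powr_of_real[of t "carpet_dim - 2"] by (simp add: h_def)
  have "carpet_density \<delta> t *\<^sub>R (complex_of_real t powr (?D - 2)) = of_real (carpet_density \<delta> t * h t)" for t
    by (cases "0 < t") (auto simp: hc scaleR_conv_of_real carpet_density_def)
  with int have int': "integrable lborel (\<lambda>t. carpet_density \<delta> t * h t)"
    by (simp only: complex_of_real_integrable_eq)
  define c where "c = 8 / (2 powr carpet_dim * 8) / (carpet_dim * (carpet_dim - 1))"
  have c: "0 < c" using carpet_dim_bounds by (simp add: c_def)
  have summand: "has_bochner_integral lborel (\<lambda>t. indicator {0<..} t * hole_density k t * h t) c" for k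
  proof -
    have "has_bochner_integral lborel (\<lambda>t. (indicator {0<..} t * hole_density k t) *\<^sub>R (complex_of_real t powr (?D - 2)))
       (8 ^ Suc k * of_real (1 / (2 * 3 ^ Suc k)) powr ?D / (?D * (?D - 1)))"
      using carpet_dim_bounds by (intro has_bochner_integral_hole) simp
    also have "8 ^ Suc k * of_real (1 / (2 * 3 ^ Suc k)) powr ?D / (?D * (?D - 1)) = of_real c"
    proof -
      have "(2::complex) powr ?D = of_real (2 powr carpet_dim)" "(3::complex) powr ?D = 8"
        using powr_of_real[of 2 carpet_dim] powr_of_real[of 3 carpet_dim] by simp_all
      then show ?thesis unfolding hole_term_geometric by (simp add: c_def)
    qed
    also have "(\<lambda>t. (indicator {0<..} t * hole_density k t) *\<^sub>R (complex_of_real t powr (?D - 2))) =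
        (\<lambda>t. complex_of_real (indicator {0<..} t * hole_density k t * h t))"
    proof
      fix t :: real
      show "(indicator {0<..} t * hole_density k t) *\<^sub>R (complex_of_real t powr (?D - 2)) =
        complex_of_real (indicator {0<..} t * hole_density k t * h t)"
        by (cases "0 < t") (auto simp: hc scaleR_conv_of_real)
    qed
    finally show ?thesis by (simp only: has_bochner_integral_iff complex_of_real_integrable_eq integral_complex_of_real of_real_eq_iff)
  qed
  have "real n * c \<le> (\<integral>t. carpet_density \<delta> t * h t \<partial>lborel)" for n
  proof -
    have "has_bochner_integral lborel (\<lambda>t. \<Sum>k<n. indicator {0<..} t * hole_density k t * h t) (\<Sum>k<n. c)"
      by (intro has_bochner_integral_sum summand)
    then have "real n * c = (\<integral>t. (\<Sum>k<n. indicator {0<..} t * hole_density k t * h t) \<partial>lborel)"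
      "integrable lborel (\<lambda>t. \<Sum>k<n. indicator {0<..} t * hole_density k t * h t)"
      by (simp_all add: has_bochner_integral_iff)
    moreover have "(\<Sum>k<n. indicator {0<..} t * hole_density k t * h t) \<le> carpet_density \<delta> t * h t" for t
    proof -
      let ?a = "\<lambda>k. indicator {0<..} t * hole_density k t"
      have sm: "summable ?a" by (rule summable_truncated_hole_density)
      have "complex_of_real (carpet_density \<delta> t) = of_real (indicator {0<..<\<delta>} t * (4 + 2 * pi * t)) + (\<Sum>k. of_real (?a k))"
        using carpet_density_split[OF \<delta>, of t 1] by (simp add: scaleR_conv_of_real)
      also have "(\<Sum>k. complex_of_real (?a k)) = of_real (\<Sum>k. ?a k)"
        using suminf_of_real[OF sm] by metis
      finally have "carpet_density \<delta> t = indicator {0<..<\<delta>} t * (4 + 2 * pi * t) + (\<Sum>k. ?a k)"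
        by (simp only: of_real_add[symmetric] of_real_eq_iff)
      moreover have "(\<Sum>k<n. ?a k) \<le> (\<Sum>k. ?a k)"
        by (intro sum_le_suminf sm) (auto simp: hole_density_nonneg)
      moreover have "0 \<le> indicator {0<..<\<delta>} t * (4 + 2 * pi * t)"
        by (auto split: split_indicator intro: add_nonneg_nonneg)
      ultimately have "(\<Sum>k<n. ?a k) \<le> carpet_density \<delta> t" by linarith
      then show ?thesis
        unfolding sum_distrib_right[symmetric] by (intro mult_right_mono) (auto simp: h_def)
    qed
    ultimately show ?thesis by (metis (no_types, lifting) integral_mono[OF _ int'])
  qed
  then show False
    using c reals_Archimedean3[OF c] by (metis not_le mult.commute)
qed

lemma abscissa_carpet:
  assumes \<delta>: "1 / 6 < \<delta>"
  shows "abscissa sierpinski_carpet \<delta> = ereal carpet_dim"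
  unfolding abscissa_def
proof (rule antisym)
  let ?S = "{ereal \<sigma> | \<sigma>. \<forall>s. Re s > \<sigma> \<longrightarrow> set_integrable lebesgue (nbhd sierpinski_carpet \<delta>) (dist_power sierpinski_carpet s)}"
  show "Inf ?S \<le> ereal carpet_dim"
    using carpet_zeta_integral(1)[OF \<delta>] by (intro Inf_lower) auto
  show "ereal carpet_dim \<le> Inf ?S"
  proof (rule Inf_greatest)
    fix x assume "x \<in> ?S"
    then obtain \<sigma> where x: "x = ereal \<sigma>"
      and \<sigma>: "\<And>s. Re s > \<sigma> \<Longrightarrow> set_integrable lebesgue (nbhd sierpinski_carpet \<delta>) (dist_power sierpinski_carpet s)"
      by blast
    have "\<not> \<sigma> < carpet_dim" using \<sigma>[of "of_real carpet_dim"] carpet_zeta_divergent[OF \<delta>] by auto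
    then show "ereal carpet_dim \<le> x" by (simp add: x)
  qed
qed

text \<open>All poles of the zeta function are treated through this form: the singular factor is isolated in
\<open>G\<close> and everything else is moved to the analytic numerator.\<close>

section \<open>The meromorphic extension and its poles\<close>

lemma simple_pole_quotient:
  assumes N: "N analytic_on {z}" and G: "G analytic_on {z}"
    and G0: "G z = 0" and G': "(G has_field_derivative d) (at z)" "d \<noteq> 0" and N0: "N z \<noteq> 0"
    and f: "\<forall>\<^sub>F w in at z. f w = N w / G w"
  shows "is_pole f z" "zorder f z = -1" "residue f z = N z / d"
proof -
  obtain S T where ST: "open S" "z \<in> S" "N holomorphic_on S" "open T" "z \<in> T" "G holomorphic_on T"
    using N G by (auto simp: analytic_at)
  then obtain e where e: "0 < e" "ball z e \<subseteq> S \<inter> T"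
    by (meson IntI open_Int open_contains_ball)
  have "zorder (\<lambda>w. N w / G w) z = -1"
    by (rule porder_simple_pole_deriv[of N "ball z e" G z d]) (use e ST G0 G' N0 in \<open>auto intro: holomorphic_on_subset\<close>)
  moreover have "residue (\<lambda>w. N w / G w) z = N z / d"
    by (rule residue_simple_pole_deriv[of N "ball z e" G z d]) (use e ST G0 G' N0 in \<open>auto intro: holomorphic_on_subset\<close>)
  moreover have "is_pole (\<lambda>w. N w / G w) z"
  proof (rule is_pole_divide)
    show "isCont N z" using N by (rule analytic_at_imp_isCont)
    have "((\<lambda>w. (G w - G z) / (w - z)) \<longlongrightarrow> d) (at z)"
      using G'(1) by (simp add: has_field_derivative_iff)
    then have "\<forall>\<^sub>F w in at z. (G w - G z) / (w - z) \<noteq> 0"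
      using G'(2) by (rule tendsto_imp_eventually_ne)
    then have "\<forall>\<^sub>F w in at z. G w \<noteq> 0"
      by eventually_elim (auto simp: G0)
    moreover have "(G \<longlongrightarrow> 0) (at z)"
      using analytic_at_imp_isCont[OF G] by (simp add: isCont_def G0)
    ultimately show "filterlim G (at 0) (at z)" by (simp add: filterlim_at)
  qed (rule N0)
  ultimately show "is_pole f z" "zorder f z = -1" "residue f z = N z / d"
    using is_pole_cong[OF f refl] zorder_cong[OF f refl] residue_cong[OF f refl] by simp_all
qed

lemma exp_of_real_ln: "0 < x \<Longrightarrow> exp (complex_of_real (ln x)) = of_real x"
  by (simp add: exp_of_real)

lemma carpet_dim_ne: "carpet_dim \<noteq> 0" "carpet_dim \<noteq> 1"
  using carpet_dim_bounds(1) by linarith+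

lemma three_powr_eq_8_iff: "3 powr s = (8::complex) \<longleftrightarrow> s \<in> range carpet_pole"
proof -
  have ln3: "complex_of_real (ln 3) \<noteq> 0" by simp
  have "(8::complex) = exp (of_real (ln 8))" using exp_of_real_ln[of 8] by simp
  then have "3 powr s = 8 \<longleftrightarrow> (\<exists>k::int. s * of_real (ln 3) = of_real (ln 8) + (of_int (2 * k) * pi) * \<i>)"
    by (simp only: numeral_powr_exp exp_eq)
  also have "\<dots> \<longleftrightarrow> (\<exists>k. s = carpet_pole k)"
    unfolding carpet_pole_def log_def using ln3 by (simp add: field_simps)
  finally show ?thesis by auto
qed

lemma Re_carpet_pole: "Re (carpet_pole k) = carpet_dim"
  by (simp add: carpet_pole_def)

lemma carpet_pole_ne: "carpet_pole k \<noteq> 0" "carpet_pole k \<noteq> 1"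
  using Re_carpet_pole[of k] carpet_dim_ne by auto

lemma carpet_zeta_formula_exp:
  "0 < \<delta> \<Longrightarrow> carpet_zeta_formula \<delta> = (\<lambda>s. 8 / (exp (s * of_real (ln 2)) * s * (s - 1) * (exp (s * of_real (ln 3)) - 8))
         + 2 * of_real pi * (exp (s * of_real (ln \<delta>)) / s)
         + 4 * (exp ((s - 1) * of_real (ln \<delta>)) / (s - 1)))"
  unfolding carpet_zeta_formula_def numeral_powr_exp by (simp only: of_real_powr_exp)

lemma carpet_zeta_formula_analytic:
  assumes "0 < \<delta>" "s \<noteq> 0" "s \<noteq> 1" "3 powr s \<noteq> 8"
  shows "carpet_zeta_formula \<delta> analytic_on {s}"
  unfolding carpet_zeta_formula_exp[OF assms(1)]
  using assms(2-4) unfolding numeral_powr_exp by (auto intro!: analytic_intros)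

lemma carpet_zeta_formula_meromorphic:
  assumes "0 < \<delta>"
  shows "carpet_zeta_formula \<delta> meromorphic_on UNIV"
proof -
  have [meromorphic_intros]: "(\<lambda>s. exp (a s)) meromorphic_on UNIV" if "a analytic_on UNIV" for a :: "complex \<Rightarrow> complex"
    using that by (intro analytic_on_imp_meromorphic_on analytic_intros)
  show ?thesis
    unfolding carpet_zeta_formula_exp[OF assms] by (intro meromorphic_intros analytic_intros)
qed

text \<open>The numerator at 0 collects \<open>8/7\<close> from the holes and \<open>2 * pi\<close> from the
corners of the outer neighbourhood, so the two singularities do not cancel.\<close>

lemma carpet_zeta_formula_pole_0:
  assumes \<delta>: "0 < \<delta>"
  shows "is_pole (carpet_zeta_formula \<delta>) 0" "zorder (carpet_zeta_formula \<delta>) 0 = -1"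
proof -
  define N :: "complex \<Rightarrow> complex" where
    "N = (\<lambda>s. 8 / (exp (s * of_real (ln 2)) * (s - 1) * (exp (s * of_real (ln 3)) - 8))
         + 2 * of_real pi * exp (s * of_real (ln \<delta>)) + s * (4 * (exp ((s - 1) * of_real (ln \<delta>)) / (s - 1))))"
  have N: "N analytic_on {0}"
    unfolding N_def by (auto intro!: analytic_intros)
  have "N 0 = of_real (8 / 7 + 2 * pi)" by (simp add: N_def)
  moreover have "8 / 7 + 2 * pi \<noteq> 0" using pi_gt_zero by linarith
  ultimately have N0: "N 0 \<noteq> 0" by (metis of_real_eq_0_iff)
  have ev: "\<forall>\<^sub>F s in at 0. carpet_zeta_formula \<delta> s = N s / s"
    unfolding eventually_at_filter
    by (intro always_eventually allI impI)
      (simp add: carpet_zeta_formula_exp[OF \<delta>] N_def add_divide_distrib mult.assoc mult.commute[of "exp _"] mult.left_commute[of "exp _"])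
  show "is_pole (carpet_zeta_formula \<delta>) 0" "zorder (carpet_zeta_formula \<delta>) 0 = -1"
    by (rule simple_pole_quotient[OF N _ _ _ _ N0 ev, of 1]; auto intro!: analytic_intros)+
qed

text \<open>The numerator at 1 collects \<open>-4/5\<close> from the holes and \<open>4\<close> from the sides
of the square, so the two singularities do not cancel.\<close>

lemma carpet_zeta_formula_pole_1:
  assumes \<delta>: "0 < \<delta>"
  shows "is_pole (carpet_zeta_formula \<delta>) 1" "zorder (carpet_zeta_formula \<delta>) 1 = -1"
proof -
  define N :: "complex \<Rightarrow> complex" where
    "N = (\<lambda>s. 8 / (exp (s * of_real (ln 2)) * s * (exp (s * of_real (ln 3)) - 8))
         + (s - 1) * (2 * of_real pi * (exp (s * of_real (ln \<delta>)) / s)) + 4 * exp ((s - 1) * of_real (ln \<delta>)))"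
  have e: "exp (complex_of_real (ln 2)) = 2" "exp (complex_of_real (ln 3)) = 3"
    using exp_of_real_ln[of 2] exp_of_real_ln[of 3] by simp_all
  have N: "N analytic_on {1}"
    unfolding N_def using e by (auto intro!: analytic_intros)
  have N0: "N 1 \<noteq> 0" by (simp add: N_def e)
  have ev: "\<forall>\<^sub>F s in at 1. carpet_zeta_formula \<delta> s = N s / (s - 1)"
    unfolding eventually_at_filter
    by (intro always_eventually allI impI)
      (simp add: carpet_zeta_formula_exp[OF \<delta>] N_def add_divide_distrib mult.assoc mult.commute[of "exp _"] mult.left_commute[of "exp _"])
  show "is_pole (carpet_zeta_formula \<delta>) 1" "zorder (carpet_zeta_formula \<delta>) 1 = -1"
    by (rule simple_pole_quotient[OF N _ _ _ _ N0 ev, of 1]; auto intro!: analytic_intros derivative_eq_intros)+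
qed

lemma carpet_zeta_formula_principal_pole:
  assumes \<delta>: "0 < \<delta>" and z_def: "z = carpet_pole k"
  shows "is_pole (carpet_zeta_formula \<delta>) z" "zorder (carpet_zeta_formula \<delta>) z = -1"
    "residue (carpet_zeta_formula \<delta>) z = 2 powr (- z) / (of_real (ln 3) * z * (z - 1))"
proof -
  define M :: "complex \<Rightarrow> complex" where
    "M = (\<lambda>s. 2 * of_real pi * (exp (s * of_real (ln \<delta>)) / s) + 4 * (exp ((s - 1) * of_real (ln \<delta>)) / (s - 1)))"
  define G :: "complex \<Rightarrow> complex" where "G = (\<lambda>s. exp (s * of_real (ln 3)) - 8)"
  define N where "N = (\<lambda>s. 8 / (exp (s * of_real (ln 2)) * s * (s - 1)) + G s * M s)"
  have z: "z \<noteq> 0" "z \<noteq> 1" using carpet_pole_ne by (auto simp: z_def)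
  have z8: "exp (z * of_real (ln 3)) = 8"
    using three_powr_eq_8_iff[of z] by (auto simp: numeral_powr_exp z_def)
  have Ga: "G analytic_on {z}" unfolding G_def by (auto intro!: analytic_intros)
  have N: "N analytic_on {z}"
    unfolding N_def M_def using z Ga by (auto intro!: analytic_intros)
  have G0: "G z = 0" by (simp add: G_def z8)
  have N0: "N z \<noteq> 0" using z by (simp add: N_def G0)
  have G': "(G has_field_derivative 8 * of_real (ln 3)) (at z)"
    unfolding G_def using z8 by (auto intro!: derivative_eq_intros)
  have d0: "8 * complex_of_real (ln 3) \<noteq> 0" by simp
  have "\<forall>\<^sub>F s in at z. (G s - G z) / (s - z) \<noteq> 0"
    using G' d0 unfolding has_field_derivative_iff by (rule tendsto_imp_eventually_ne)
  then have ev: "\<forall>\<^sub>F s in at z. carpet_zeta_formula \<delta> s = N s / G s"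
  proof eventually_elim
    case (elim s)
    then have "G s \<noteq> 0" by (auto simp: G0)
    moreover have "carpet_zeta_formula \<delta> s = 8 / (exp (s * of_real (ln 2)) * s * (s - 1) * G s) + M s"
      by (simp add: carpet_zeta_formula_exp[OF \<delta>] M_def G_def add.assoc)
    ultimately show ?case
      by (simp add: N_def add_divide_distrib)
  qed
  note q = simple_pole_quotient[OF N Ga G0 G' d0 N0 ev]
  show "is_pole (carpet_zeta_formula \<delta>) z" "zorder (carpet_zeta_formula \<delta>) z = -1" by (rule q)+
  have "N z / (8 * of_real (ln 3)) = 2 powr (- z) / (of_real (ln 3) * z * (z - 1))"
    using z by (simp add: N_def G0 numeral_powr_exp exp_minus field_simps)
  then show "residue (carpet_zeta_formula \<delta>) z = 2 powr (- z) / (of_real (ln 3) * z * (z - 1))"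
    using q(3) by simp
qed

lemma nicely_meromorphic_eq_remove_sings:
  "f nicely_meromorphic_on UNIV \<Longrightarrow> remove_sings f z = f z"
  unfolding nicely_meromorphic_on_def by (metis UNIV_I remove_sings_at_pole remove_sings_eqI)

text \<open>The identity theorem. The difference vanishes on an open set, hence everywhere up to removable
singularities, and these are excluded by the normalization of the values.\<close>

lemma nicely_meromorphic_eq_half_plane:
  assumes f: "f nicely_meromorphic_on UNIV" and g: "g nicely_meromorphic_on UNIV"
    and eq: "\<And>s. c < Re s \<Longrightarrow> f s = g s"
  shows "f = g"
proof
  fix z
  define h where "h = remove_sings (\<lambda>s. f s - g s)"
  have mero: "(\<lambda>s. f s - g s) meromorphic_on UNIV"
    using f g by (intro meromorphic_on_diff) (auto simp: nicely_meromorphic_on_def)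
  have h: "h nicely_meromorphic_on UNIV" unfolding h_def by (rule remove_sings_nicely_meromorphic[OF mero])
  have H: "open {s. c < Re s}" by (rule open_halfspace_Re_gt)
  have nh: "h s = 0" if "c < Re s" for s
  proof -
    have "\<forall>\<^sub>F w in at s. w \<in> {s. c < Re s}" using that H by (intro eventually_at_in_open') auto
    then have "\<forall>\<^sub>F w in at s. f w - g w = 0" by eventually_elim (simp add: eq)
    then show ?thesis unfolding h_def by (intro remove_sings_eqI tendsto_eventually)
  qed
  have "\<forall>\<^sub>F w in at (of_real (c + 1)). w \<in> {s. c < Re s}" using H by (intro eventually_at_in_open') auto
  then have "\<forall>\<^sub>F w in at (of_real (c + 1)). h w = 0" by eventually_elim (simp add: nh)
  then have "\<exists>\<^sub>F w in at (of_real (c + 1)). h w = 0" by (intro eventually_frequently) simp_all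
  then have h0: "h w = 0" for w
    using frequently_eq_meromorphic_imp_constant[OF _ h] by blast
  have "\<forall>\<^sub>F w in at z. h w = f w - g w"
    unfolding h_def using mero by (intro eventually_remove_sings_eq_at) (auto intro: meromorphic_on_isolated_singularity meromorphic_on_subset)
  then have "\<forall>\<^sub>F w in at z. f w = g w" by eventually_elim (simp add: h0)
  then have "remove_sings f z = remove_sings g z" by (intro remove_sings_cong) auto
  then show "f z = g z" using f g by (simp add: nicely_meromorphic_eq_remove_sings)
qed

lemma carpet_zeta_mero:
  assumes \<delta>: "1 / 6 < \<delta>"
  shows "\<exists>!Z. zeta_extension sierpinski_carpet \<delta> Z"
    and "zeta_mero sierpinski_carpet \<delta> = remove_sings (carpet_zeta_formula \<delta>)"
proof -
  have \<delta>0: "0 < \<delta>" using \<delta> by simp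
  let ?Z = "remove_sings (carpet_zeta_formula \<delta>)"
  have Z: "zeta_extension sierpinski_carpet \<delta> ?Z"
    unfolding zeta_extension_def abscissa_carpet[OF \<delta>]
  proof (intro conjI allI impI)
    show "?Z nicely_meromorphic_on UNIV"
      by (intro remove_sings_nicely_meromorphic carpet_zeta_formula_meromorphic \<delta>0)
    fix s assume "ereal carpet_dim < ereal (Re s)"
    then have s: "carpet_dim < Re s" by simp
    then have "s \<noteq> 0" "s \<noteq> 1" "3 powr s \<noteq> 8"
      using carpet_dim_bounds(1) hole_ratio_less_1[OF s] by (auto simp: norm_divide)
    then show "?Z s = distance_zeta sierpinski_carpet \<delta> s"
      using carpet_zeta_integral(2)[OF \<delta> s] carpet_zeta_formula_analytic[OF \<delta>0] by simp
  qed
  have uniq: "Z' = ?Z" if "zeta_extension sierpinski_carpet \<delta> Z'" for Z'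
    using that Z unfolding zeta_extension_def abscissa_carpet[OF \<delta>]
    by (intro nicely_meromorphic_eq_half_plane[of _ _ carpet_dim]) auto
  show "\<exists>!Z. zeta_extension sierpinski_carpet \<delta> Z" using Z uniq by blast
  show "zeta_mero sierpinski_carpet \<delta> = ?Z"
    unfolding zeta_mero_def using Z uniq by (rule the_equality)
qed

lemma carpet_complex_dims:
  assumes \<delta>: "1 / 6 < \<delta>"
  shows "complex_dims sierpinski_carpet \<delta> = {0, 1} \<union> range carpet_pole"
    and "principal_complex_dims sierpinski_carpet \<delta> = range carpet_pole"
    and "s \<in> complex_dims sierpinski_carpet \<delta> \<Longrightarrow> zorder (zeta_mero sierpinski_carpet \<delta>) s = -1"
    and "residue (zeta_mero sierpinski_carpet \<delta>) (carpet_pole k) =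
       2 powr (- carpet_pole k) / (of_real (ln 3) * carpet_pole k * (carpet_pole k - 1))"
proof -
  have \<delta>0: "0 < \<delta>" using \<delta> by simp
  have iso: "isolated_singularity_at (carpet_zeta_formula \<delta>) s" for s
    using carpet_zeta_formula_meromorphic[OF \<delta>0] by (auto intro: meromorphic_on_isolated_singularity meromorphic_on_subset)
  note Z = carpet_zeta_mero(2)[OF \<delta>]
  have "is_pole (carpet_zeta_formula \<delta>) s \<longleftrightarrow> s \<in> {0, 1} \<union> range carpet_pole" for s
    using carpet_zeta_formula_analytic[OF \<delta>0, of s] analytic_at_imp_no_pole three_powr_eq_8_iff[of s]
      carpet_zeta_formula_pole_0[OF \<delta>0] carpet_zeta_formula_pole_1[OF \<delta>0] carpet_zeta_formula_principal_pole[OF \<delta>0 refl]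
    by blast
  then show dims: "complex_dims sierpinski_carpet \<delta> = {0, 1} \<union> range carpet_pole"
    using iso by (auto simp: complex_dims_def Z)
  show "principal_complex_dims sierpinski_carpet \<delta> = range carpet_pole"
    unfolding principal_complex_dims_def dims abscissa_carpet[OF \<delta>]
    using carpet_dim_ne by (auto simp: Re_carpet_pole)
  show "zorder (zeta_mero sierpinski_carpet \<delta>) s = -1" if "s \<in> complex_dims sierpinski_carpet \<delta>"
    using that iso carpet_zeta_formula_pole_0[OF \<delta>0] carpet_zeta_formula_pole_1[OF \<delta>0] carpet_zeta_formula_principal_pole[OF \<delta>0 refl]
    unfolding dims Z by auto
  show "residue (zeta_mero sierpinski_carpet \<delta>) (carpet_pole k) =
       2 powr (- carpet_pole k) / (of_real (ln 3) * carpet_pole k * (carpet_pole k - 1))"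
    using iso carpet_zeta_formula_principal_pole(3)[OF \<delta>0 refl] by (simp add: Z)
qed

text \<open>The multiplicatively periodic part of the Minkowski quotient, over one period
\<open>{1/6..1/2}\<close>.\<close>

section \<open>Minkowski contents as extrema of a periodic profile\<close>

definition carpet_profile :: "real \<Rightarrow> real" where
  "carpet_profile u = (1 + 4/5 * u - 4/7 * u\<^sup>2) * u powr (carpet_dim - 2)"

text \<open>The contribution of the outer neighbourhood and of the boundary terms of the geometric sums.\<close>

definition carpet_remainder :: "real \<Rightarrow> real" where
  "carpet_remainder t = 16/5 * t powr (carpet_dim - 1) + (pi + 4/7) * t powr carpet_dim"

lemma three_powr_nat_dim: "((1::real) / 3 ^ m) powr (2 - carpet_dim) = (8/9) ^ m"
proof -
  have "3 powr (carpet_dim - 2) = 8 / (9::real)"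
    by (simp add: powr_diff)
  then have "(3 powr (carpet_dim - 2)) ^ m = (8/9 :: real) ^ m" by (simp only:)
  moreover have "((1::real) / 3 ^ m) powr (2 - carpet_dim) = (3 powr (carpet_dim - 2)) ^ m"
  proof -
    have "(1::real) / 3 ^ m = 3 powr (- real m)" by (simp add: powr_minus powr_realpow inverse_eq_divide)
    then show ?thesis by (simp add: powr_powr flip: powr_realpow) (simp add: powr_realpow powr_power algebra_simps)
  qed
  ultimately show ?thesis by simp
qed

text \<open>With \<open>t = u / 3 ^ m\<close> the first \<open>m\<close> generations of holes have side at
least \<open>2 * t\<close> and the others at most \<open>2 * t\<close>, so the area formula is a
finite combination of geometric sums.\<close>

lemma nbhd_measure_scaled:
  assumes u: "1/6 \<le> u" "u \<le> 1/2" and t: "t = u / 3 ^ m"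
  shows "measure lebesgue (nbhd sierpinski_carpet t) =
    (8/9) ^ m * (1 + 4/5 * u - 4/7 * u\<^sup>2) + 16/5 * t + (pi + 4/7) * t\<^sup>2"
proof -
  have t0: "0 < t" using u by (simp add: t)
  have scaled: "t * (8/3) ^ m = (8/9) ^ m * u" "t\<^sup>2 * 8 ^ m = (8/9) ^ m * u\<^sup>2"
  proof -
    have nine: "(9::real) ^ m = 3 ^ m * 3 ^ m" by (simp flip: power_mult_distrib)
    show "t * (8/3) ^ m = (8/9) ^ m * u" "t\<^sup>2 * 8 ^ m = (8/9) ^ m * u\<^sup>2"
      by (simp_all add: t power_divide nine power2_eq_square)
  qed
  let ?s = "\<lambda>k. 8 ^ k * (max 0 (1 / 3 ^ Suc k - 2 * t))\<^sup>2"
  have zero: "?s k = 0" if "k \<notin> {..<m}" for k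
  proof -
    have "1 / 3 ^ Suc k \<le> (1 / 3 ^ Suc m :: real)"
      using that by (intro divide_left_mono power_increasing) auto
    also have "\<dots> \<le> 2 * t" using u by (simp add: t field_simps)
    finally show ?thesis by simp
  qed
  have "(\<Sum>k<n. 8 ^ k * (1 / 3 ^ Suc k - 2 * t)\<^sup>2) =
      1 - (8/9) ^ n - 4 * t * ((8/3) ^ n - 1) / 5 + 4 * t\<^sup>2 * (8 ^ n - 1) / 7" for n
  proof (induction n)
    case (Suc n)
    have "8 ^ n * (1 / 3 ^ Suc n - 2 * t)\<^sup>2 = (8/9) ^ n / 9 - 4 * t * (8/3) ^ n / 3 + 4 * t\<^sup>2 * 8 ^ n"
    proof -
      have nine: "(9::real) ^ n = 3 ^ n * 3 ^ n" by (simp flip: power_mult_distrib)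
      show ?thesis by (simp add: power_divide nine field_simps power2_eq_square)
    qed
    note step = this
    define X Y Z where XYZ: "X = (8/9::real) ^ n" "Y = (8/3::real) ^ n" "Z = (8::real) ^ n"
    show ?case
      unfolding sum.lessThan_Suc Suc.IH step unfolding power_Suc XYZ[symmetric]
      by (simp add: field_simps)
  qed simp
  moreover have "(\<Sum>k<m. ?s k) = (\<Sum>k<m. 8 ^ k * (1 / 3 ^ Suc k - 2 * t)\<^sup>2)"
  proof (intro sum.cong refl)
    fix k assume "k \<in> {..<m}"
    then have "1 / 3 ^ m \<le> (1 / 3 ^ Suc k :: real)"
      by (intro divide_left_mono power_increasing) auto
    moreover have "2 * t \<le> 1 / 3 ^ m" using u by (simp add: t field_simps)
    ultimately show "?s k = 8 ^ k * (1 / 3 ^ Suc k - 2 * t)\<^sup>2" by simp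
  qed
  moreover have "(\<Sum>k<m. ?s k) = 1 + 4 * t + pi * t\<^sup>2 - measure lebesgue (nbhd sierpinski_carpet t)"
    using sums_unique2[OF sums_finite[OF finite_lessThan zero] carpet_nbhd_measure(2)[OF t0]] by simp
  ultimately have "measure lebesgue (nbhd sierpinski_carpet t) =
     4 * t + pi * t\<^sup>2 + (8/9) ^ m + 4 * t * ((8/3) ^ m - 1) / 5 - 4 * t\<^sup>2 * (8 ^ m - 1) / 7"
    by simp
  also have "\<dots> = (8/9) ^ m + 4/5 * (t * (8/3) ^ m) - 4/7 * (t\<^sup>2 * 8 ^ m) + 16/5 * t + (pi + 4/7) * t\<^sup>2"
    by (simp add: algebra_simps diff_divide_distrib)
  also note scaled(1)
  also note scaled(2)
  finally show ?thesis by (simp add: algebra_simps)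
qed

text \<open>The normalizing power turns \<open>(8/9) ^ m\<close> into a power of \<open>u\<close> because
\<open>3 powr (log 3 8 - 2) = 8/9\<close>.\<close>

lemma minkowski_ratio:
  assumes u: "1/6 \<le> u" "u \<le> 1/2" and t: "t = u / 3 ^ m"
  shows "measure lebesgue (nbhd sierpinski_carpet t) / t powr (2 - carpet_dim) = carpet_profile u + carpet_remainder t"
proof -
  have t0: "0 < t" using u by (simp add: t)
  have "t powr (2 - carpet_dim) = u powr (2 - carpet_dim) * (1 / 3 ^ m) powr (2 - carpet_dim)"
    using u by (subst powr_mult[symmetric]) (auto simp: t)
  then have "t powr (2 - carpet_dim) = u powr (2 - carpet_dim) * (8/9) ^ m"
    unfolding three_powr_nat_dim .
  then have "(8/9) ^ m * (1 + 4/5 * u - 4/7 * u\<^sup>2) / t powr (2 - carpet_dim) = carpet_profile u"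
    using u powr_minus_divide[of u "2 - carpet_dim"] by (simp add: carpet_profile_def)
  moreover have "(16/5 * t + (pi + 4/7) * t\<^sup>2) / t powr (2 - carpet_dim) = carpet_remainder t"
  proof -
    have "t / t powr (2 - carpet_dim) = t powr (carpet_dim - 1)"
      using t0 powr_diff[of t 1 "2 - carpet_dim"] by simp
    moreover have "t\<^sup>2 / t powr (2 - carpet_dim) = t powr carpet_dim"
      using t0 powr_diff[of t 2 "2 - carpet_dim"] by simp
    ultimately show ?thesis unfolding carpet_remainder_def add_divide_distrib times_divide_eq_right[symmetric] by simp
  qed
  ultimately show ?thesis
    unfolding nbhd_measure_scaled[OF assms] add.assoc add_divide_distrib[of "_ * _" "_ + _"] by simp
qed

lemma carpet_scale_exists:
  fixes t :: real
  assumes t: "0 < t" "t < 1/2"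
  obtains u m where "1/6 \<le> u" "u \<le> 1/2" "t = u / 3 ^ m"
proof -
  obtain n where n: "1 / t < 3 ^ n" using real_arch_pow[of 3 "1/t"] by auto
  then have ex: "1/2 < 3 ^ n * t" using t by (simp add: field_simps)
  \<comment> \<open>The last scale before \<open>3 ^ n * t\<close> exceeds 1/2 puts it into \<open>{1/6..1/2}\<close>.\<close>
  define k where "k = (LEAST n. 1/2 < 3 ^ n * t)"
  have k: "1/2 < 3 ^ k * t" unfolding k_def using ex by (rule LeastI)
  then have "k \<noteq> 0" using t by (intro notI) simp
  then obtain m where m: "k = Suc m" using not0_implies_Suc by blast
  have "\<not> 1/2 < 3 ^ m * t" using not_less_Least[of m "\<lambda>n. 1/2 < 3 ^ n * t"] m by (simp add: k_def)
  then show ?thesis using k by (intro that[of "3 ^ m * t" m]) (auto simp: m)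
qed

lemma carpet_remainder_nonneg: "0 \<le> carpet_remainder t"
  by (simp add: carpet_remainder_def)

lemma carpet_remainder_tendsto: "(carpet_remainder \<longlongrightarrow> 0) (at_right 0)"
proof -
  have "((\<lambda>t. t powr a) \<longlongrightarrow> 0) (at_right (0::real))" if "0 < a" for a
  proof -
    have "\<forall>\<^sub>F t in at_right (0::real). 0 \<le> t"
      by (rule eventually_mono[OF eventually_at_right_less]) simp
    from tendsto_powr2[OF tendsto_ident_at tendsto_const this that] show ?thesis by simp
  qed
  then have "((\<lambda>t. 16/5 * t powr (carpet_dim - 1) + (pi + 4/7) * t powr carpet_dim) \<longlongrightarrow> 16/5 * 0 + (pi + 4/7) * 0) (at_right (0::real))"
    using carpet_dim_bounds(1) by (intro tendsto_add tendsto_mult tendsto_const) auto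
  then show ?thesis by (simp add: carpet_remainder_def[abs_def])
qed

abbreviation minkowski_quotient :: "real \<Rightarrow> ereal" where
  "minkowski_quotient t \<equiv> ereal (measure lebesgue (nbhd sierpinski_carpet t) / t powr (2 - carpet_dim))"

lemma eventually_below_half: "\<forall>\<^sub>F t in at_right (0::real). t \<in> {0<..<1/2}"
  by (rule eventually_at_right_real) simp

lemma lower_content_ge:
  assumes c: "\<And>u. 1/6 \<le> u \<Longrightarrow> u \<le> 1/2 \<Longrightarrow> c \<le> carpet_profile u"
  shows "ereal c \<le> lower_minkowski_content carpet_dim sierpinski_carpet"
proof -
  have "\<forall>\<^sub>F t in at_right 0. ereal c \<le> minkowski_quotient t"
    using eventually_below_half
  proof eventually_elim
    case (elim t)
    then obtain u m where um: "1/6 \<le> u" "u \<le> 1/2" "t = u / 3 ^ m" using carpet_scale_exists by auto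
    show ?case using minkowski_ratio[OF um] c[OF um(1,2)] carpet_remainder_nonneg[of t] by simp
  qed
  then show ?thesis unfolding lower_minkowski_content_def by (intro Liminf_bounded) simp
qed

lemma upper_content_le:
  assumes c: "\<And>u. 1/6 \<le> u \<Longrightarrow> u \<le> 1/2 \<Longrightarrow> carpet_profile u \<le> c" and "c < d"
  shows "upper_minkowski_content carpet_dim sierpinski_carpet \<le> ereal d"
proof -
  have "\<forall>\<^sub>F t in at_right 0. carpet_remainder t < d - c"
    using carpet_remainder_tendsto \<open>c < d\<close> by (intro order_tendstoD(2)) auto
  with eventually_below_half have "\<forall>\<^sub>F t in at_right 0. minkowski_quotient t \<le> ereal d"
  proof eventually_elim
    case (elim t)
    then have r: "carpet_remainder t < d - c" by simp
    from elim obtain u m where um: "1/6 \<le> u" "u \<le> 1/2" "t = u / 3 ^ m" using carpet_scale_exists by auto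
    show "minkowski_quotient t \<le> ereal d" using minkowski_ratio[OF um] c[OF um(1,2)] r by simp
  qed
  then show ?thesis unfolding upper_minkowski_content_def by (intro Limsup_bounded) simp
qed

lemma minkowski_quotient_subsequence:
  assumes u: "1/6 \<le> u" "u \<le> 1/2"
  shows "filterlim (\<lambda>m. u / 3 ^ m) (at_right 0) sequentially"
    and "(\<lambda>m. minkowski_quotient (u / 3 ^ m)) \<longlonglongrightarrow> ereal (carpet_profile u)"
proof -
  have "(\<lambda>m. u * (1/3) ^ m) \<longlonglongrightarrow> u * 0" by (intro tendsto_mult tendsto_const LIMSEQ_power_zero) simp
  then have "(\<lambda>m. u / 3 ^ m) \<longlonglongrightarrow> 0" by (simp add: power_divide)
  then show flt: "filterlim (\<lambda>m. u / 3 ^ m) (at_right 0) sequentially"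
    using u by (auto simp: filterlim_at)
  have "(\<lambda>m. carpet_profile u + carpet_remainder (u / 3 ^ m)) \<longlonglongrightarrow> carpet_profile u + 0"
    by (intro tendsto_add tendsto_const filterlim_compose[OF carpet_remainder_tendsto flt])
  then show "(\<lambda>m. minkowski_quotient (u / 3 ^ m)) \<longlonglongrightarrow> ereal (carpet_profile u)"
    using minkowski_ratio[OF u refl] by simp
qed

text \<open>Along \<open>t = u / 3 ^ m\<close> the quotient tends to the profile at \<open>u\<close>, which
gives an upper bound of the lower limit.\<close>

lemma lower_content_le:
  assumes u: "1/6 \<le> u" "u \<le> 1/2"
  shows "lower_minkowski_content carpet_dim sierpinski_carpet \<le> ereal (carpet_profile u)"
proof (rule ccontr)
  assume "\<not> ?thesis"
  then obtain y where y: "ereal (carpet_profile u) < y" "y < lower_minkowski_content carpet_dim sierpinski_carpet"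
    using dense by (auto simp: not_le)
  then have "\<forall>\<^sub>F t in at_right 0. y < minkowski_quotient t"
    unfolding lower_minkowski_content_def by (auto dest: less_LiminfD)
  then have "\<forall>\<^sub>F m in sequentially. y < minkowski_quotient (u / 3 ^ m)"
    using minkowski_quotient_subsequence(1)[OF u] by (auto dest: eventually_compose_filterlim)
  moreover have "\<forall>\<^sub>F m in sequentially. minkowski_quotient (u / 3 ^ m) < y"
    using minkowski_quotient_subsequence(2)[OF u] y(1) by (rule order_tendstoD(2))
  ultimately have "\<forall>\<^sub>F m in sequentially. False" by eventually_elim simp
  then show False by simp
qed

lemma upper_content_ge:
  assumes u: "1/6 \<le> u" "u \<le> 1/2"
  shows "ereal (carpet_profile u) \<le> upper_minkowski_content carpet_dim sierpinski_carpet"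
proof (rule ccontr)
  assume "\<not> ?thesis"
  then obtain y where y: "y < ereal (carpet_profile u)" "upper_minkowski_content carpet_dim sierpinski_carpet < y"
    using dense by (auto simp: not_le)
  then have "\<forall>\<^sub>F t in at_right 0. minkowski_quotient t < y"
    unfolding upper_minkowski_content_def by (auto dest: Limsup_lessD)
  then have "\<forall>\<^sub>F m in sequentially. minkowski_quotient (u / 3 ^ m) < y"
    using minkowski_quotient_subsequence(1)[OF u] by (auto dest: eventually_compose_filterlim)
  moreover have "\<forall>\<^sub>F m in sequentially. y < minkowski_quotient (u / 3 ^ m)"
    using minkowski_quotient_subsequence(2)[OF u] y(1) by (rule order_tendstoD(1))
  ultimately have "\<forall>\<^sub>F m in sequentially. False" by eventually_elim simp
  then show False by simp
qed

text \<open>The logarithm of the profile: its derivative is rational in \<open>u\<close>, and it can be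
evaluated from values of \<open>ln\<close>.\<close>

section \<open>The shape of the profile\<close>

definition carpet_log_profile :: "real \<Rightarrow> real" where
  "carpet_log_profile u = ln (1 + 4/5 * u - 4/7 * u\<^sup>2) + (carpet_dim - 2) * ln u"

text \<open>The numerator of the derivative of the logarithmic profile: a concave quadratic polynomial in
\<open>u\<close>.\<close>

definition carpet_slope :: "real \<Rightarrow> real" where
  "carpet_slope u = (carpet_dim - 2) + 4/5 * (carpet_dim - 1) * u - 4/7 * carpet_dim * u\<^sup>2"

lemma profile_factor_ge_1:
  fixes u :: real
  assumes "0 \<le> u" "u \<le> 1/2"
  shows "1 \<le> 1 + 4/5 * u - 4/7 * u\<^sup>2"
proof -
  have "u * u \<le> 1/2 * u" using assms by (intro mult_right_mono) auto
  then show ?thesis using assms by (simp add: power2_eq_square)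
qed

lemma carpet_profile_eq_exp:
  assumes "0 < u" "u \<le> 1/2"
  shows "carpet_profile u = exp (carpet_log_profile u)"
  using assms profile_factor_ge_1[of u]
  by (simp add: carpet_profile_def carpet_log_profile_def exp_add powr_def)

lemma carpet_log_profile_deriv:
  assumes u: "0 < u" "u \<le> 1/2"
  shows "(carpet_log_profile has_real_derivative carpet_slope u / (u * (1 + 4/5 * u - 4/7 * u\<^sup>2))) (at u)"
proof -
  have p: "0 < 1 + 4/5 * u - 4/7 * u\<^sup>2" using profile_factor_ge_1[of u] u by linarith
  have "(carpet_log_profile has_real_derivative (4/5 - 8/7 * u) / (1 + 4/5 * u - 4/7 * u\<^sup>2) + (carpet_dim - 2) / u) (at u)"
    unfolding carpet_log_profile_def[abs_def] using u p by (auto intro!: derivative_eq_intros)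
  moreover have "(4/5 - 8/7 * u) / (1 + 4/5 * u - 4/7 * u\<^sup>2) + (carpet_dim - 2) / u = carpet_slope u / (u * (1 + 4/5 * u - 4/7 * u\<^sup>2))"
  proof -
    define P where "P = 1 + 4/5 * u - 4/7 * u\<^sup>2"
    have "carpet_slope u = (4/5 - 8/7 * u) * u + (carpet_dim - 2) * P"
      by (simp add: carpet_slope_def P_def field_simps power2_eq_square)
    then show ?thesis unfolding P_def[symmetric] using u p[folded P_def] by (simp add: add_divide_distrib)
  qed
  ultimately show ?thesis by simp
qed

text \<open>A one-sided mean value estimate that tolerates a small error in the sign of the slope; taking
\<open>\<sigma>\<close> to be 1 or -1 bounds the increase or the decrease. The derivative is the
slope divided by a quantity of at least \<open>1/6\<close>, and the interval has length at most
\<open>1/3\<close>, whence the factor 2.\<close>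

lemma carpet_log_profile_increase_le:
  assumes ab: "1/6 \<le> a" "a \<le> b" "b \<le> 1/2" and \<eta>: "0 \<le> \<eta>"
    and slope: "\<And>u. a \<le> u \<Longrightarrow> u \<le> b \<Longrightarrow> \<sigma> * carpet_slope u \<le> \<eta>"
  shows "\<sigma> * (carpet_log_profile b - carpet_log_profile a) \<le> 2 * \<eta>"
proof -
  let ?h = "\<lambda>u. \<sigma> * carpet_log_profile u - 6 * \<eta> * u"
  have "?h b \<le> ?h a"
  proof (rule DERIV_nonpos_imp_nonincreasing[OF ab(2)])
    fix u assume u: "a \<le> u" "u \<le> b"
    let ?P = "1 + 4/5 * u - 4/7 * u\<^sup>2"
    have P: "1 \<le> ?P" using profile_factor_ge_1[of u] u ab by simp
    have D: "(?h has_real_derivative \<sigma> * (carpet_slope u / (u * ?P)) - 6 * \<eta> * 1) (at u)"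
      using u ab by (intro DERIV_diff DERIV_cmult carpet_log_profile_deriv DERIV_ident) auto
    \<comment> \<open>The denominator of the derivative is at least \<open>1/6\<close>, so a slope of at most \<open>\<eta>\<close> gives a derivative of at most \<open>6 * \<eta>\<close>.\<close>
    have "1/6 * 1 \<le> u * ?P" using u ab P by (intro mult_mono) auto
    then have "\<eta> * (1/6 * 1) \<le> \<eta> * (u * ?P)" using \<eta> by (rule mult_left_mono)
    then have "\<eta> \<le> 6 * \<eta> * (u * ?P)" by linarith
    then have "\<sigma> * carpet_slope u \<le> 6 * \<eta> * (u * ?P)" using slope[OF u] by linarith
    moreover have "0 < u * ?P" using u ab P by (intro mult_pos_pos) auto
    ultimately have "\<sigma> * (carpet_slope u / (u * ?P)) \<le> 6 * \<eta>" by (simp only: times_divide_eq_right pos_divide_le_eq)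
    then show "\<exists>y. (?h has_real_derivative y) (at u) \<and> y \<le> 0" using D by (intro exI conjI) auto
  qed
  moreover have "\<eta> * (b - a) \<le> \<eta> * (1/3)" using ab \<eta> by (intro mult_left_mono) auto
  ultimately show ?thesis by (simp add: algebra_simps)
qed

lemma ln_2_bounds: "(69314718055 / 100000000000) \<le> ln (2::real)" "ln 2 \<le> ((69314718057 / 100000000000) :: real)"
  using ln_approx_bounds[of 2 11] by (simp_all add: eval_nat_numeral)

lemma ln_3_bounds: "(109861228866 / 100000000000) \<le> ln (3::real)" "ln 3 \<le> ((109861228868 / 100000000000) :: real)"
  using ln_approx_bounds[of 3 18] by (simp_all add: eval_nat_numeral)

text \<open>The bounds are on \<open>2 - log 3 8\<close>, the exponent of the profile up to sign, because this
difference multiplies the logarithms below.\<close>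

lemma carpet_codim_bounds:
  "107210738 / 1000000000 \<le> 2 - carpet_dim" "2 - carpet_dim \<le> 107210740 / 1000000000"
proof -
  have pos: "0 < ln (3::real)" by simp
  have eq: "2 - carpet_dim = (2 * ln 3 - 3 * ln 2) / ln 3"
    using ln_realpow[of 2 3] by (simp add: log_def field_simps)
  have "107210738 / 1000000000 * ln 3 \<le> 2 * ln 3 - 3 * ln (2::real)"
    "2 * ln 3 - 3 * ln (2::real) \<le> 107210740 / 1000000000 * ln 3"
    using ln_2_bounds ln_3_bounds by linarith+
  then show "107210738 / 1000000000 \<le> 2 - carpet_dim" "2 - carpet_dim \<le> 107210740 / 1000000000"
    unfolding eq pos_le_divide_eq[OF pos] pos_divide_le_eq[OF pos] .
qed

text \<open>A rational number within \<open>2 * 10 ^ (-8)\<close> of the smaller zero of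
\<open>carpet_slope\<close>, where the profile has its minimum.\<close>

definition profile_argmin :: real where "profile_argmin = (2307124 / 10000000)"
text \<open>A rational number within \<open>2 * 10 ^ (-8)\<close> of the larger zero of
\<open>carpet_slope\<close>, where the profile has its maximum.\<close>

definition profile_argmax :: real where "profile_argmax = (4296384 / 10000000)"
abbreviation slope_tol :: real where "slope_tol \<equiv> (1 / 100000000)"

lemma slope_at_critical:
  "\<bar>carpet_slope profile_argmin\<bar> \<le> slope_tol" "\<bar>carpet_slope profile_argmax\<bar> \<le> slope_tol"
  using carpet_codim_bounds
  unfolding carpet_slope_def profile_argmin_def profile_argmax_def abs_le_iff power2_eq_square
  by (simp_all add: field_simps)

lemma slope_diff:
  "carpet_slope u - carpet_slope r = (u - r) * (4/5 * (carpet_dim - 1) - 4/7 * carpet_dim * (u + r))"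
  by (simp add: carpet_slope_def field_simps power2_eq_square)

lemma slope_left: "u \<le> profile_argmin \<Longrightarrow> carpet_slope u \<le> slope_tol"
proof -
  assume u: "u \<le> profile_argmin"
  define K where "K = carpet_dim * (u + profile_argmin)"
  have "K \<le> carpet_dim * (1/2)"
    unfolding K_def using carpet_dim_bounds(1) u by (intro mult_left_mono) (auto simp: profile_argmin_def)
  moreover have "0 \<le> 4/5 * (d - 1) - 4/7 * k"
    if "k \<le> d * (1/2)" "2 - d \<le> 107210740 / 1000000000" for d k :: real using that by (simp add: field_simps)
  ultimately have "0 \<le> 4/5 * (carpet_dim - 1) - 4/7 * K"
    using carpet_codim_bounds(2) by blast
  then have "0 \<le> 4/5 * (carpet_dim - 1) - 4/7 * carpet_dim * (u + profile_argmin)"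
    by (simp only: K_def mult.assoc)
  then have "carpet_slope u - carpet_slope profile_argmin \<le> 0"
    unfolding slope_diff using u by (intro mult_nonpos_nonneg) auto
  then show ?thesis using slope_at_critical(1) by linarith
qed

lemma slope_right: "profile_argmax \<le> u \<Longrightarrow> carpet_slope u \<le> slope_tol"
proof -
  assume u: "profile_argmax \<le> u"
  define K where "K = carpet_dim * (u + profile_argmax)"
  have "carpet_dim * (4/5) \<le> K"
    unfolding K_def using carpet_dim_bounds(1) u by (intro mult_left_mono) (auto simp: profile_argmax_def)
  moreover have "4/5 * (d - 1) - 4/7 * k \<le> 0"
    if "d * (4/5) \<le> k" "107210738 / 1000000000 \<le> 2 - d" for d k :: real using that by (simp add: field_simps)
  ultimately have "4/5 * (carpet_dim - 1) - 4/7 * K \<le> 0"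
    using carpet_codim_bounds(1) by blast
  then have "4/5 * (carpet_dim - 1) - 4/7 * carpet_dim * (u + profile_argmax) \<le> 0"
    by (simp only: K_def mult.assoc)
  then have "carpet_slope u - carpet_slope profile_argmax \<le> 0"
    unfolding slope_diff using u by (intro mult_nonneg_nonpos) auto
  then show ?thesis using slope_at_critical(2) by linarith
qed

text \<open>A concave function lies above its chord, and at both ends of the chord the slope is nearly zero.\<close>

lemma slope_middle:
  assumes u: "profile_argmin \<le> u" "u \<le> profile_argmax"
  shows "- slope_tol \<le> carpet_slope u"
proof -
  let ?a = profile_argmin and ?b = profile_argmax
  have ab: "0 < ?b - ?a" by (simp add: profile_argmin_def profile_argmax_def)
  have "(?b - ?a) * carpet_slope u =
      (?b - u) * carpet_slope ?a + (u - ?a) * carpet_slope ?b + 4/7 * carpet_dim * ((u - ?a) * (?b - u) * (?b - ?a))"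
    by (simp add: carpet_slope_def field_simps power2_eq_square)
  moreover have "0 \<le> 4/7 * carpet_dim * ((u - ?a) * (?b - u) * (?b - ?a))"
    using carpet_dim_bounds(1) u ab by (intro mult_nonneg_nonneg) auto
  moreover have "(?b - u) * (- slope_tol) \<le> (?b - u) * carpet_slope ?a" "(u - ?a) * (- slope_tol) \<le> (u - ?a) * carpet_slope ?b"
    using slope_at_critical u by (intro mult_left_mono; auto simp: abs_le_iff)+
  moreover have "(?b - u) * (- slope_tol) + (u - ?a) * (- slope_tol) = (?b - ?a) * (- slope_tol)"
    by (simp add: field_simps)
  ultimately have "(?b - ?a) * (- slope_tol) \<le> (?b - ?a) * carpet_slope u" by linarith
  then show ?thesis using ab by (simp only: mult_le_cancel_left_pos)
qed

text \<open>The two ends of the period describe the same radius \<open>t\<close>, once with \<open>m\<close>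
and once with \<open>m + 1\<close>.\<close>

lemma carpet_log_profile_ends: "carpet_log_profile (1/6) = carpet_log_profile (1/2)"
proof -
  have dim: "carpet_dim * ln 3 = 3 * ln 2"
    using ln_realpow[of 2 3] by (simp add: log_def)
  have quot: "ln (352/315) = ln (44/35) + 3 * ln 2 - 2 * ln (3::real)"
  proof -
    have "352/315 = (44/35 :: real) * (2 ^ 3 / 3\<^sup>2)" by simp
    also have "ln \<dots> = ln (44/35) + ln (2 ^ 3 / 3\<^sup>2)" by (rule ln_mult_pos) simp_all
    also have "ln (2 ^ 3 / 3\<^sup>2 :: real) = ln (2 ^ 3) - ln (3\<^sup>2)" by (rule ln_divide_pos) simp_all
    also have "\<dots> = 3 * ln 2 - 2 * ln 3"
      using ln_realpow[of 2 3] ln_realpow[of 3 2] by simp_all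
    finally show ?thesis by simp
  qed
  have ln6: "ln (1/6) = - ln 2 - ln (3::real)" "ln (1/2) = - ln (2::real)"
    using ln_mult[of 2 "3::real"] by (simp_all add: ln_div)
  have "carpet_log_profile (1/6) = ln (352/315) + (carpet_dim - 2) * ln (1/6)"
    by (simp add: carpet_log_profile_def power2_eq_square)
  also have "\<dots> = ln (44/35) + (carpet_dim - 2) * ln (1/2) - carpet_dim * ln 3 + 3 * ln 2"
    unfolding quot ln6 by (simp add: algebra_simps)
  also have "\<dots> = ln (44/35) + (carpet_dim - 2) * ln (1/2)"
    unfolding dim by simp
  also have "\<dots> = carpet_log_profile (1/2)"
    by (simp add: carpet_log_profile_def power2_eq_square)
  finally show ?thesis .
qed

lemma argmin_argmax_order: "1/6 \<le> profile_argmin" "profile_argmin \<le> profile_argmax" "profile_argmax \<le> 1/2"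
  by (simp_all add: profile_argmin_def profile_argmax_def)

text \<open>Up to the tolerance the profile decreases, increases and decreases. On the left and right parts,
comparison with the opposite extremum passes through the common value at the two ends, which costs
the tolerance twice.\<close>

lemma carpet_log_profile_between:
  assumes u: "1/6 \<le> u" "u \<le> 1/2"
  shows "carpet_log_profile profile_argmin - 4 * slope_tol \<le> carpet_log_profile u"
    and "carpet_log_profile u \<le> carpet_log_profile profile_argmax + 4 * slope_tol"
proof -
  let ?h = carpet_log_profile and ?a = profile_argmin and ?b = profile_argmax
  note ord = argmin_argmax_order
  have left: "?h y - ?h x \<le> 2 * slope_tol" if "1/6 \<le> x" "x \<le> y" "y \<le> ?a" for x y
    using carpet_log_profile_increase_le[of x y slope_tol 1] slope_left that ord by auto
  have right: "?h y - ?h x \<le> 2 * slope_tol" if "?b \<le> x" "x \<le> y" "y \<le> 1/2" for x y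
    using carpet_log_profile_increase_le[of x y slope_tol 1] slope_right that ord by auto
  have middle: "?h x - ?h y \<le> 2 * slope_tol" if "?a \<le> x" "x \<le> y" "y \<le> ?b" for x y
  proof -
    have "- 1 * (?h y - ?h x) \<le> 2 * slope_tol"
    proof (rule carpet_log_profile_increase_le)
      fix v assume "x \<le> v" "v \<le> y"
      then show "- 1 * carpet_slope v \<le> slope_tol" using slope_middle[of v] that by linarith
    qed (use that ord in auto)
    then show ?thesis by simp
  qed
  consider "u \<le> ?a" | "?a \<le> u" "u \<le> ?b" | "?b \<le> u" by linarith
  then have "?h ?a - 4 * slope_tol \<le> ?h u \<and> ?h u \<le> ?h ?b + 4 * slope_tol"
  proof cases
    case 1
    then show ?thesis
      using left[of u ?a] left[of "1/6" u] right[of ?b "1/2"] u ord carpet_log_profile_ends by auto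
  next
    case 2
    then show ?thesis using middle[of ?a u] middle[of u ?b] by auto
  next
    case 3
    then show ?thesis
      using right[of u "1/2"] right[of ?b u] left[of "1/6" ?a] u ord carpet_log_profile_ends by auto
  qed
  then show "?h ?a - 4 * slope_tol \<le> ?h u" "?h u \<le> ?h ?b + 4 * slope_tol" by auto
qed

text \<open>The series of \<open>ln ((1 + y) / (1 - y))\<close> cut after four terms; for the values \<open>y
< 1/12\<close> used below the error is less than \<open>10 ^ (-10)\<close>.\<close>

section \<open>Numerical bounds for the extrema\<close>

lemma ln_bounds:
  fixes x y l h :: real
  assumes "1 < x" and y: "y = (x - 1) / (x + 1)"
    and l: "l \<le> 2 * (y + y ^ 3 / 3 + y ^ 5 / 5 + y ^ 7 / 7)"
    and h: "2 * (y + y ^ 3 / 3 + y ^ 5 / 5 + y ^ 7 / 7) + 2 * (y ^ 9 / (1 - y\<^sup>2) / 9) \<le> h"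
  shows "l \<le> ln x \<and> ln x \<le> h"
  using ln_approx_bounds[OF assms(1), of 4] l h unfolding y[symmetric]
  by (simp_all add: eval_nat_numeral)

text \<open>The argument is \<open>1 / (4 * profile_argmin)\<close>; the factor 4 brings it close to 1.\<close>

lemma ln_inverse_argmin:
  "8028900463 / 100000000000 \<le> ln (625000 / 576781 :: real) \<and> ln (625000 / 576781 :: real) \<le> 8028900470 / 100000000000"
  by (rule ln_bounds[where y = "48219 / 1201781"]) (simp_all add: power_divide)

text \<open>The argument is \<open>1 / (2 * profile_argmax)\<close>; the factor 2 brings it close to 1.\<close>

lemma ln_inverse_argmax:
  "15166417371 / 100000000000 \<le> ln (78125 / 67131 :: real) \<and> ln (78125 / 67131 :: real) \<le> 15166417378 / 100000000000"
  by (rule ln_bounds[where y = "5497 / 72628"]) (simp_all add: power_divide)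

text \<open>In this and the next three lemmas the arguments are one of the bounds 1.3506699, 1.3506704,
1.3556173, 1.3556168 for the contents, divided by \<open>1 + 4/5 * u - 4/7 * u\<^sup>2\<close> at
the critical point, and rounded to seven decimals in the direction in which the estimate is used.\<close>

lemma ln_quotient_argmin_above:
  "1572332950 / 10000000000 \<le> ln (5851343 / 5000000 :: real) \<and> ln (5851343 / 5000000 :: real) \<le> 1572332953 / 10000000000"
  by (rule ln_bounds[where y = "851343 / 10851343"]) (simp_all add: power_divide)

lemma ln_quotient_argmin_below:
  "1572335513 / 10000000000 \<le> ln (11702689 / 10000000 :: real) \<and> ln (11702689 / 10000000 :: real) \<le> 1572335516 / 10000000000"
  by (rule ln_bounds[where y = "1702689 / 21702689"]) (simp_all add: power_divide)

lemma ln_quotient_argmax_below: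
  "905729768 / 10000000000 \<le> ln (5474007 / 5000000 :: real) \<and> ln (5474007 / 5000000 :: real) \<le> 905729771 / 10000000000"
  by (rule ln_bounds[where y = "474007 / 10474007"]) (simp_all add: power_divide)

lemma ln_quotient_argmax_above:
  "905727028 / 10000000000 \<le> ln (10948011 / 10000000 :: real) \<and> ln (10948011 / 10000000 :: real) \<le> 905727031 / 10000000000"
  by (rule ln_bounds[where y = "948011 / 20948011"]) (simp_all add: power_divide)

lemma log_profile_argmin:
  "carpet_log_profile profile_argmin = ln (1 + 4/5 * profile_argmin - 4/7 * profile_argmin\<^sup>2) + (2 - carpet_dim) * (2 * ln 2 + ln (625000 / 576781))"
proof -
  have "profile_argmin = 1 / (2\<^sup>2 * (625000 / 576781))" by (simp add: profile_argmin_def)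
  then have "ln profile_argmin = ln (1 / (2\<^sup>2 * (625000 / 576781)))" by (simp only:)
  also have "\<dots> = ln 1 - ln (2\<^sup>2 * (625000 / 576781))" by (rule ln_divide_pos) simp_all
  also have "ln (2\<^sup>2 * (625000 / 576781) :: real) = ln (2\<^sup>2) + ln (625000 / 576781)" by (rule ln_mult_pos) simp_all
  also have "ln (2\<^sup>2 :: real) = 2 * ln 2" using ln_realpow[of 2 2] by simp
  finally have "ln profile_argmin = - (2 * ln 2 + ln (625000 / 576781))" by simp
  moreover have "(carpet_dim - 2) * - L = (2 - carpet_dim) * L" for L :: real by (simp add: algebra_simps)
  ultimately show ?thesis unfolding carpet_log_profile_def by (simp only:)
qed

lemma log_profile_argmax:
  "carpet_log_profile profile_argmax = ln (1 + 4/5 * profile_argmax - 4/7 * profile_argmax\<^sup>2) + (2 - carpet_dim) * (ln 2 + ln (78125 / 67131))"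
proof -
  have "profile_argmax = 1 / (2 * (78125 / 67131))" by (simp add: profile_argmax_def)
  then have "ln profile_argmax = ln (1 / (2 * (78125 / 67131)))" by (simp only:)
  also have "\<dots> = ln 1 - ln (2 * (78125 / 67131))" by (rule ln_divide_pos) simp_all
  also have "ln (2 * (78125 / 67131) :: real) = ln 2 + ln (78125 / 67131)" by (rule ln_mult_pos) simp_all
  finally have "ln profile_argmax = - (ln 2 + ln (78125 / 67131))" by simp
  moreover have "(carpet_dim - 2) * - L = (2 - carpet_dim) * L" for L :: real by (simp add: algebra_simps)
  ultimately show ?thesis unfolding carpet_log_profile_def by (simp only:)
qed

lemma mult_between:
  fixes a b c d x y :: real
  assumes "a \<le> x" "x \<le> b" "c \<le> y" "y \<le> d" "0 \<le> a" "0 \<le> c"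
  shows "a * c \<le> x * y" "x * y \<le> b * d"
  using assms by (auto intro!: mult_mono)

lemma exponent_at_argmin:
  "157233484 / 1000000000 \<le> (2 - carpet_dim) * (2 * ln 2 + ln (625000 / 576781))"
  "(2 - carpet_dim) * (2 * ln 2 + ln (625000 / 576781)) \<le> 157233489 / 1000000000"
proof -
  let ?L = "2 * ln 2 + ln (625000 / 576781) :: real"
  have L: "146658336573 / 100000000000 \<le> ?L" "?L \<le> 146658336584 / 100000000000"
    using ln_2_bounds ln_inverse_argmin by linarith+
  note D = carpet_codim_bounds
  have "157233484 / 1000000000 \<le> (107210738 / 1000000000) * (146658336573 / 100000000000 :: real)"
    "(107210740 / 1000000000) * (146658336584 / 100000000000) \<le> (157233489 / 1000000000 :: real)" by simp_all
  with mult_between[OF D L] show "157233484 / 1000000000 \<le> (2 - carpet_dim) * ?L" "(2 - carpet_dim) * ?L \<le> 157233489 / 1000000000"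
    by (meson order_trans divide_nonneg_nonneg zero_le_numeral)+
qed

lemma exponent_at_argmax:
  "90572848 / 1000000000 \<le> (2 - carpet_dim) * (ln 2 + ln (78125 / 67131))"
  "(2 - carpet_dim) * (ln 2 + ln (78125 / 67131)) \<le> 90572851 / 1000000000"
proof -
  let ?L = "ln 2 + ln (78125 / 67131) :: real"
  have L: "84481135426 / 100000000000 \<le> ?L" "?L \<le> 84481135435 / 100000000000"
    using ln_2_bounds ln_inverse_argmax by linarith+
  note D = carpet_codim_bounds
  have "90572848 / 1000000000 \<le> (107210738 / 1000000000) * (84481135426 / 100000000000 :: real)"
    "(107210740 / 1000000000) * (84481135435 / 100000000000) \<le> (90572851 / 1000000000 :: real)" by simp_all
  with mult_between[OF D L] show "90572848 / 1000000000 \<le> (2 - carpet_dim) * ?L" "(2 - carpet_dim) * ?L \<le> 90572851 / 1000000000"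
    by (meson order_trans divide_nonneg_nonneg zero_le_numeral)+
qed

lemma profile_factor_pos:
  "0 < 1 + 4/5 * profile_argmin - 4/7 * profile_argmin\<^sup>2" "0 < 1 + 4/5 * profile_argmax - 4/7 * profile_argmax\<^sup>2"
  using profile_factor_ge_1[of profile_argmin] profile_factor_ge_1[of profile_argmax] argmin_argmax_order by linarith+

text \<open>The chosen bounds differ from the true extrema by about \<open>2 * 10 ^ (-7)\<close> to \<open>3 *
10 ^ (-7)\<close>; this leaves room for the tolerance, and they stay within \<open>5 * 10 ^
(-7)\<close> of the rounded values 1.350670 and 1.355617.\<close>

lemma ln_content_bounds:
  shows "ln (13506699 / 10000000) + 4 * slope_tol \<le> carpet_log_profile profile_argmin"
    and "carpet_log_profile profile_argmin \<le> ln (13506704 / 10000000)"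
    and "ln (13556168 / 10000000) \<le> carpet_log_profile profile_argmax"
    and "carpet_log_profile profile_argmax + 4 * slope_tol \<le> ln (13556173 / 10000000)"
proof -
  let ?P = "\<lambda>u::real. 1 + 4/5 * u - 4/7 * u\<^sup>2"
  have "13506699 / 10000000 \<le> 5851343 / 5000000 * ?P profile_argmin"
    by (simp add: profile_argmin_def power_divide)
  then have "ln (13506699 / 10000000) \<le> ln (5851343 / 5000000 * ?P profile_argmin)"
    by (intro ln_mono) simp_all
  also have "\<dots> = ln (5851343 / 5000000) + ln (?P profile_argmin)"
    using profile_factor_pos by (intro ln_mult_pos) simp_all
  finally have "ln (13506699 / 10000000) \<le> ln (5851343 / 5000000) + ln (?P profile_argmin)" .
  then show "ln (13506699 / 10000000) + 4 * slope_tol \<le> carpet_log_profile profile_argmin"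
    using ln_quotient_argmin_above exponent_at_argmin unfolding log_profile_argmin by linarith
  have "11702689 / 10000000 * ?P profile_argmin \<le> 13506704 / 10000000"
    by (simp add: profile_argmin_def power_divide)
  moreover have pos: "0 < 11702689 / 10000000 * ?P profile_argmin"
    using profile_factor_pos by (intro mult_pos_pos) simp_all
  ultimately have "ln (11702689 / 10000000 * ?P profile_argmin) \<le> ln (13506704 / 10000000)"
    by (intro ln_mono) simp_all
  moreover have "ln (11702689 / 10000000 * ?P profile_argmin) = ln (11702689 / 10000000) + ln (?P profile_argmin)"
    using profile_factor_pos by (intro ln_mult_pos) simp_all
  ultimately have "ln (11702689 / 10000000) + ln (?P profile_argmin) \<le> ln (13506704 / 10000000)" by simp
  then show "carpet_log_profile profile_argmin \<le> ln (13506704 / 10000000)"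
    using ln_quotient_argmin_below exponent_at_argmin unfolding log_profile_argmin by linarith
  have "13556168 / 10000000 \<le> 10948011 / 10000000 * ?P profile_argmax"
    by (simp add: profile_argmax_def power_divide)
  then have "ln (13556168 / 10000000) \<le> ln (10948011 / 10000000 * ?P profile_argmax)"
    by (intro ln_mono) simp_all
  also have "\<dots> = ln (10948011 / 10000000) + ln (?P profile_argmax)"
    using profile_factor_pos by (intro ln_mult_pos) simp_all
  finally have "ln (13556168 / 10000000) \<le> ln (10948011 / 10000000) + ln (?P profile_argmax)" .
  then show "ln (13556168 / 10000000) \<le> carpet_log_profile profile_argmax"
    using ln_quotient_argmax_above exponent_at_argmax unfolding log_profile_argmax by linarith
  have "5474007 / 5000000 * ?P profile_argmax \<le> 13556173 / 10000000"
    by (simp add: profile_argmax_def power_divide)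
  moreover have pos: "0 < 5474007 / 5000000 * ?P profile_argmax"
    using profile_factor_pos by (intro mult_pos_pos) simp_all
  ultimately have "ln (5474007 / 5000000 * ?P profile_argmax) \<le> ln (13556173 / 10000000)"
    by (intro ln_mono) simp_all
  moreover have "ln (5474007 / 5000000 * ?P profile_argmax) = ln (5474007 / 5000000) + ln (?P profile_argmax)"
    using profile_factor_pos by (intro ln_mult_pos) simp_all
  ultimately have "ln (5474007 / 5000000) + ln (?P profile_argmax) \<le> ln (13556173 / 10000000)" by simp
  then show "carpet_log_profile profile_argmax + 4 * slope_tol \<le> ln (13556173 / 10000000)"
    using ln_quotient_argmax_below exponent_at_argmax unfolding log_profile_argmax by linarith
qed

lemma carpet_profile_bounds:
  assumes u: "1/6 \<le> u" "u \<le> 1/2"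
  shows "13506699 / 10000000 \<le> carpet_profile u" "carpet_profile u \<le> 13556173 / 10000000"
proof -
  have eq: "carpet_profile u = exp (carpet_log_profile u)" using u by (intro carpet_profile_eq_exp) auto
  have "ln (13506699 / 10000000) \<le> carpet_log_profile u"
    using carpet_log_profile_between(1)[OF u] ln_content_bounds(1) by linarith
  then have "exp (ln (13506699 / 10000000)) \<le> exp (carpet_log_profile u)" by (simp only: exp_le_cancel_iff)
  then show "13506699 / 10000000 \<le> carpet_profile u" unfolding eq by simp
  have "carpet_log_profile u \<le> ln (13556173 / 10000000)"
    using carpet_log_profile_between(2)[OF u] ln_content_bounds(4) by linarith
  then have "exp (carpet_log_profile u) \<le> exp (ln (13556173 / 10000000))" by (simp only: exp_le_cancel_iff)
  then show "carpet_profile u \<le> 13556173 / 10000000" unfolding eq by simp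
qed

lemma carpet_profile_extremes:
  "carpet_profile profile_argmin \<le> 13506704 / 10000000" "13556168 / 10000000 \<le> carpet_profile profile_argmax"
proof -
  have eq: "carpet_profile profile_argmin = exp (carpet_log_profile profile_argmin)"
    "carpet_profile profile_argmax = exp (carpet_log_profile profile_argmax)"
    by (intro carpet_profile_eq_exp; simp add: profile_argmin_def profile_argmax_def)+
  have "exp (carpet_log_profile profile_argmin) \<le> exp (ln (13506704 / 10000000))"
    using ln_content_bounds(2) by (simp only: exp_le_cancel_iff)
  then show "carpet_profile profile_argmin \<le> 13506704 / 10000000" unfolding eq by simp
  have "exp (ln (13556168 / 10000000)) \<le> exp (carpet_log_profile profile_argmax)"
    using ln_content_bounds(3) by (simp only: exp_le_cancel_iff)
  then show "13556168 / 10000000 \<le> carpet_profile profile_argmax" unfolding eq by simp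
qed

lemma carpet_minkowski_contents:
  "\<bar>lower_minkowski_content (log 3 8) sierpinski_carpet - ereal 1.350670\<bar> < ereal (5 / 10 ^ 7)"
  "\<bar>upper_minkowski_content (log 3 8) sierpinski_carpet - ereal 1.355617\<bar> < ereal (5 / 10 ^ 7)"
proof -
  have close: "\<bar>x - ereal c\<bar> < ereal e" if "ereal a \<le> x" "x \<le> ereal b" "c - e < a" "b < c + e" for x a b c e
    using that by (cases x) auto
  have argmin: "1/6 \<le> profile_argmin" "profile_argmin \<le> 1/2"
    and argmax: "1/6 \<le> profile_argmax" "profile_argmax \<le> 1/2"
    by (simp_all add: profile_argmin_def profile_argmax_def)
  have "lower_minkowski_content (log 3 8) sierpinski_carpet \<le> ereal (13506704 / 10000000)"
    using lower_content_le[OF argmin] carpet_profile_extremes(1) by (meson ereal_less_eq(3) order_trans)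
  then show "\<bar>lower_minkowski_content (log 3 8) sierpinski_carpet - ereal 1.350670\<bar> < ereal (5 / 10 ^ 7)"
    using lower_content_ge[OF carpet_profile_bounds(1)] by (intro close[of "13506699 / 10000000" _ "13506704 / 10000000"]) auto
  have "ereal (13556168 / 10000000) \<le> upper_minkowski_content (log 3 8) sierpinski_carpet"
    using upper_content_ge[OF argmax] carpet_profile_extremes(2) by (meson ereal_less_eq(3) order_trans)
  then show "\<bar>upper_minkowski_content (log 3 8) sierpinski_carpet - ereal 1.355617\<bar> < ereal (5 / 10 ^ 7)"
    using upper_content_le[OF carpet_profile_bounds(2), of "13556174 / 10000000"]
    by (intro close[of "13556168 / 10000000" _ "13556174 / 10000000"]) auto
qed

section \<open>The distance zeta function and the Minkowski contents of the carpet\<close>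

theorem proposition3p5:
  fixes \<delta> :: real
  assumes "\<delta> > 1/6"
  shows "(\<exists>!Z. zeta_extension sierpinski_carpet \<delta> Z) \<and>
    (\<forall>s::complex. s \<noteq> 0 \<and> s \<noteq> 1 \<and> 3 powr s \<noteq> 8 \<longrightarrow>
       zeta_mero sierpinski_carpet \<delta> s =
         8 / (2 powr s * s * (s - 1) * (3 powr s - 8))
         + 2 * of_real pi * (of_real \<delta> powr s / s)
         + 4 * (of_real \<delta> powr (s - 1) / (s - 1))) \<and>
    complex_dims sierpinski_carpet \<delta> = {0, 1} \<union> principal_complex_dims sierpinski_carpet \<delta> \<and>
    principal_complex_dims sierpinski_carpet \<delta> = range carpet_pole \<and>
    (\<forall>s \<in> complex_dims sierpinski_carpet \<delta>. zorder (zeta_mero sierpinski_carpet \<delta>) s = -1) \<and>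
    (\<forall>k. residue (zeta_mero sierpinski_carpet \<delta>) (carpet_pole k) =
       2 powr (- carpet_pole k) / (of_real (ln 3) * carpet_pole k * (carpet_pole k - 1))) \<and>
    \<bar>lower_minkowski_content (log 3 8) sierpinski_carpet - ereal 1.350670\<bar> < ereal (5 / 10 ^ 7) \<and>
    \<bar>upper_minkowski_content (log 3 8) sierpinski_carpet - ereal 1.355617\<bar> < ereal (5 / 10 ^ 7)"
proof -
  have \<delta>0: "0 < \<delta>" using assms by simp
  have formula: "zeta_mero sierpinski_carpet \<delta> s = carpet_zeta_formula \<delta> s"
    if "s \<noteq> 0" "s \<noteq> 1" "3 powr s \<noteq> 8" for s
    using carpet_zeta_formula_analytic[OF \<delta>0 that] carpet_zeta_mero(2)[OF assms] by simp
  show ?thesis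
    using carpet_zeta_mero(1)[OF assms] formula[unfolded carpet_zeta_formula_def]
      carpet_complex_dims[OF assms] carpet_minkowski_contents
    by (intro conjI ballI allI impI) auto
qed

end
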